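(* Let $\mathcal{C}$ be a small category satisfying the amalgamation and joint embedding properties, and let $u$ be a $\mathcal{C}$-universal and $\mathcal{C}$-ultrahomogeneous object of $\mathrm{Ind}\text{-}\mathcal{C}$. Then the following conditions are equivalent: (i) Every arrow $f:d\to c$ in $\mathcal{C}$ is a strict monomorphism, i.e. any arrow $g:e\to c$ in $\mathcal{C}$ such that $h\circ g=k\circ g$ whenever $h\circ f=k\circ f$ (for arrows $h,k$ of $\mathcal{C}$) factors uniquely through $f$. (ii) The functor $F:\mathcal{C}^{\mathrm{op}}\to\mathbf{Cont}_{\mathcal{I}_{\mathcal{C}}}(Aut_{\mathcal{C}}(u))$ which sends any object $c$ of $\mathcal{C}$ to the set $\mathrm{Hom}_{\mathrm{Ind}\text{-}\mathcal{C}}(c,u)$ (with the obvious action of $Aut_{\mathcal{C}}(u)$) and any arrow $f:c\to d$ in $\mathcal{C}$ to the equivariant map $-\circ f:\mathrm{Hom}_{\mathrm{Ind}\text{-}\mathcal{C}}(d,u)\to\mathrm{Hom}_{\mathrm{Ind}\text{-}\mathcal{C}}(c,u)$ is full and faithful. (iii) For any objects $c,d\in\mathcal{C}$ and any arrows $\chi:c\to u$ and $\xi:d\to u$ in $\mathrm{Ind}\text{-}\mathcal{C}$, one has $\mathcal{I}_{\xi}\subseteq\mathcal{I}_{\chi}$ (that is, for any automorphism $f$ of $u$, $f\circ\xi=\xi$ implies $f\circ\chi=\chi$) if and only if there exists a unique arrow $f:c\to d$ in $\mathcal{C}$ such that $\chi=\xi\circ f$.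
   Context: $\mathrm{Ind}\text{-}\mathcal{C}$ is the ind-completion of $\mathcal{C}$, with the canonical full embedding of $\mathcal{C}$. Amalgamation property: for all $f:a\to b$, $g:a\to c$ in $\mathcal{C}$ there are $f':b\to d$, $g':c\to d$ with $f'\circ f=g'\circ g$. Joint embedding property: any two objects $a,b$ admit arrows $a\to c$, $b\to c$ to a common object. An object $u$ of $\mathrm{Ind}\text{-}\mathcal{C}$ is $\mathcal{C}$-universal if every $a\in\mathcal{C}$ admits an arrow $a\to u$; it is $\mathcal{C}$-ultrahomogeneous if for every $j:a\to b$ in $\mathcal{C}$ and $\chi_1:a\to u$, $\chi_2:b\to u$ in $\mathrm{Ind}\text{-}\mathcal{C}$ there is an automorphism $\check{j}$ of $u$ with $\check{j}\circ\chi_1=\chi_2\circ j$. For an arrow $\chi:c\to u$ with $c\in\mathcal{C}$ put $\mathcal{I}_{\chi}:=\{f:u\cong u\mid f\circ\chi=\chi\}$, and let $\mathcal{I}_{\mathcal{C}}$ be the collection of all these subgroups. $Aut_{\mathcal{C}}(u)$ is the group of automorphisms of $u$ in $\mathrm{Ind}\text{-}\mathcal{C}$ with the group topology for which $\mathcal{I}_{\mathcal{C}}$ is a neighbourhood basis of the identity. $\mathbf{Cont}_{\mathcal{I}_{\mathcal{C}}}(Aut_{\mathcal{C}}(u))$ is the full subcategory of the topos $\mathbf{Cont}(Aut_{\mathcal{C}}(u))$ of continuous actions of $Aut_{\mathcal{C}}(u)$ on discrete sets consisting of the actions isomorphic to a coset action $Aut_{\mathcal{C}}(u)/\mathcal{I}_{\chi}$.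 *)

theory Defs
  imports
    "HOL-Analysis.Product_Topology"
    "HOL-Algebra.Group_Action"
    "HOL-Algebra.Left_Coset"
begin

section \<open>Categories and functors\<close>

record ('o, 'a) cat =
  Obj :: "'o set"
  Arr :: "'a set"
  Dom :: "'a \<Rightarrow> 'o"
  Cod :: "'a \<Rightarrow> 'o"
  Ident :: "'o \<Rightarrow> 'a"
  Comp :: "'a \<Rightarrow> 'a \<Rightarrow> 'a"  (infixl \<open>\<odot>\<index>\<close> 70)

text \<open>
  Composition is written in the order of functions: \<open>g \<odot> f\<close> is \<open>g\<close> after \<open>f\<close>. Every category in
  the sense below is small, its objects and arrows being sets of elements of HOL types.
\<close>

definition Homs :: "('o, 'a, 'm) cat_scheme \<Rightarrow> 'o \<Rightarrow> 'o \<Rightarrow> 'a set" where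
  "Homs C a b = {f \<in> Arr C. Dom C f = a \<and> Cod C f = b}"

locale category =
  fixes C :: "('o, 'a, 'm) cat_scheme" (structure)
  assumes Dom_closed: "f \<in> Arr C \<Longrightarrow> Dom C f \<in> Obj C"
    and Cod_closed: "f \<in> Arr C \<Longrightarrow> Cod C f \<in> Obj C"
    and Ident_closed: "a \<in> Obj C \<Longrightarrow> Ident C a \<in> Homs C a a"
    and Comp_closed: "\<lbrakk>f \<in> Homs C a b; g \<in> Homs C b c\<rbrakk> \<Longrightarrow> g \<odot> f \<in> Homs C a c"
    and Comp_Ident: "f \<in> Homs C a b \<Longrightarrow> f \<odot> Ident C a = f"
    and Ident_Comp: "f \<in> Homs C a b \<Longrightarrow> Ident C b \<odot> f = f"
    and Comp_assoc:
      "\<lbrakk>f \<in> Homs C a b; g \<in> Homs C b c; h \<in> Homs C c d\<rbrakk> \<Longrightarrow> (h \<odot> g) \<odot> f = h \<odot> (g \<odot> f)"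

definition opposite :: "('o, 'a) cat \<Rightarrow> ('o, 'a) cat" where
  "opposite C = \<lparr>Obj = Obj C, Arr = Arr C, Dom = Cod C, Cod = Dom C, Ident = Ident C,
     Comp = (\<lambda>g f. f \<odot>\<^bsub>C\<^esub> g)\<rparr>"

locale cat_functor =
  source: category C + target: category D
  for C :: "('o, 'a) cat" and D :: "('p, 'b) cat" +
  fixes Fo :: "'o \<Rightarrow> 'p" and Fa :: "'a \<Rightarrow> 'b"
  assumes Fo_closed: "a \<in> Obj C \<Longrightarrow> Fo a \<in> Obj D"
    and Fa_closed: "f \<in> Homs C a b \<Longrightarrow> Fa f \<in> Homs D (Fo a) (Fo b)"
    and Fa_Ident: "a \<in> Obj C \<Longrightarrow> Fa (Ident C a) = Ident D (Fo a)"
    and Fa_Comp: "\<lbrakk>f \<in> Homs C a b; g \<in> Homs C b c\<rbrakk> \<Longrightarrow> Fa (g \<odot>\<^bsub>C\<^esub> f) = Fa g \<odot>\<^bsub>D\<^esub> Fa f"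

definition full :: "('o, 'a) cat \<Rightarrow> ('p, 'b) cat \<Rightarrow> ('o \<Rightarrow> 'p) \<Rightarrow> ('a \<Rightarrow> 'b) \<Rightarrow> bool" where
  "full C D Fo Fa \<longleftrightarrow>
     (\<forall>a\<in>Obj C. \<forall>b\<in>Obj C. \<forall>g\<in>Homs D (Fo a) (Fo b). \<exists>f\<in>Homs C a b. Fa f = g)"

definition faithful :: "('o, 'a) cat \<Rightarrow> ('a \<Rightarrow> 'b) \<Rightarrow> bool" where
  "faithful C Fa \<longleftrightarrow>
     (\<forall>a\<in>Obj C. \<forall>b\<in>Obj C. \<forall>f\<in>Homs C a b. \<forall>g\<in>Homs C a b. Fa f = Fa g \<longrightarrow> f = g)"

definition full_and_faithful_functor ::
  "('o, 'a) cat \<Rightarrow> ('p, 'b) cat \<Rightarrow> ('o \<Rightarrow> 'p) \<Rightarrow> ('a \<Rightarrow> 'b) \<Rightarrow> bool" where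
  "full_and_faithful_functor C D Fo Fa \<longleftrightarrow>
     cat_functor C D Fo Fa \<and> full C D Fo Fa \<and> faithful C Fa"

definition amalgamation_property :: "('o, 'a) cat \<Rightarrow> bool" where
  "amalgamation_property C \<longleftrightarrow>
     (\<forall>a\<in>Obj C. \<forall>b\<in>Obj C. \<forall>c\<in>Obj C. \<forall>f\<in>Homs C a b. \<forall>g\<in>Homs C a c.
        \<exists>d\<in>Obj C. \<exists>f'\<in>Homs C b d. \<exists>g'\<in>Homs C c d. f' \<odot>\<^bsub>C\<^esub> f = g' \<odot>\<^bsub>C\<^esub> g)"

definition joint_embedding_property :: "('o, 'a) cat \<Rightarrow> bool" where
  "joint_embedding_property C \<longleftrightarrow>
     (\<forall>a\<in>Obj C. \<forall>b\<in>Obj C. \<exists>c\<in>Obj C. Homs C a c \<noteq> {} \<and> Homs C b c \<noteq> {})"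

definition strict_monomorphism :: "('o, 'a) cat \<Rightarrow> 'a \<Rightarrow> bool" where
  "strict_monomorphism C f \<longleftrightarrow> f \<in> Arr C \<and>
     (\<forall>e\<in>Obj C. \<forall>g\<in>Homs C e (Cod C f).
        (\<forall>b\<in>Obj C. \<forall>h\<in>Homs C (Cod C f) b. \<forall>k\<in>Homs C (Cod C f) b.
           h \<odot>\<^bsub>C\<^esub> f = k \<odot>\<^bsub>C\<^esub> f \<longrightarrow> h \<odot>\<^bsub>C\<^esub> g = k \<odot>\<^bsub>C\<^esub> g) \<longrightarrow>
        (\<exists>!x. x \<in> Homs C e (Dom C f) \<and> f \<odot>\<^bsub>C\<^esub> x = g))"

definition Isos :: "('o, 'a) cat \<Rightarrow> 'o \<Rightarrow> 'o \<Rightarrow> 'a set" where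
  "Isos C a b = {f \<in> Homs C a b. \<exists>g\<in>Homs C b a. g \<odot>\<^bsub>C\<^esub> f = Ident C a \<and> f \<odot>\<^bsub>C\<^esub> g = Ident C b}"

definition Aut :: "('o, 'a) cat \<Rightarrow> 'o \<Rightarrow> 'a monoid" where
  "Aut C u = \<lparr>carrier = Isos C u u, mult = Comp C, one = Ident C u\<rparr>"


section \<open>The ind-completion\<close>

definition filtered :: "('i, 'j) cat \<Rightarrow> bool" where
  "filtered J \<longleftrightarrow> category J \<and> Obj J \<noteq> {} \<and>
     (\<forall>i\<in>Obj J. \<forall>j\<in>Obj J. \<exists>k\<in>Obj J. Homs J i k \<noteq> {} \<and> Homs J j k \<noteq> {}) \<and>
     (\<forall>i\<in>Obj J. \<forall>j\<in>Obj J. \<forall>s\<in>Homs J i j. \<forall>t\<in>Homs J i j.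
        \<exists>k\<in>Obj J. \<exists>r\<in>Homs J j k. r \<odot>\<^bsub>J\<^esub> s = r \<odot>\<^bsub>J\<^esub> t)"

text \<open>
  The objects of Ind-C are the small filtered diagrams in C, and
  \<open>Hom(D, E) = lim\<^sub>i colim\<^sub>k C(D i, E k)\<close>. The types of the index categories are parameters; in
  statements about an ind-object they are arbitrary type variables.
\<close>

record ('i, 'j, 'o, 'a) diagram =
  Index :: "('i, 'j) cat"
  Ob :: "'i \<Rightarrow> 'o"
  Ar :: "'j \<Rightarrow> 'a"

text \<open>
  The set \<open>colim\<^sub>k C(c, E k)\<close> is the quotient of the disjoint union of the hom-sets by the
  following relation, which is an equivalence relation because the index category is filtered.
\<close>

definition colim_rel ::
  "('o, 'a) cat \<Rightarrow> 'o \<Rightarrow> ('i, 'j, 'o, 'a) diagram \<Rightarrow> (('i \<times> 'a) \<times> ('i \<times> 'a)) set" where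
  "colim_rel C c E =
     {((k, f), (l, g)) | k f l g.
        k \<in> Obj (Index E) \<and> f \<in> Homs C c (Ob E k) \<and>
        l \<in> Obj (Index E) \<and> g \<in> Homs C c (Ob E l) \<and>
        (\<exists>m\<in>Obj (Index E). \<exists>s\<in>Homs (Index E) k m. \<exists>t\<in>Homs (Index E) l m.
           Ar E s \<odot>\<^bsub>C\<^esub> f = Ar E t \<odot>\<^bsub>C\<^esub> g)}"

definition colim_hom ::
  "('o, 'a) cat \<Rightarrow> 'o \<Rightarrow> ('i, 'j, 'o, 'a) diagram \<Rightarrow> ('i \<times> 'a) set set" where
  "colim_hom C c E = (SIGMA k : Obj (Index E). Homs C c (Ob E k)) // colim_rel C c E"

text \<open>The map \<open>colim\<^sub>k C(c, E k) \<rightarrow> colim\<^sub>k C(d, E k)\<close> given by precomposition with \<open>h : d \<rightarrow> c\<close>.\<close>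

definition colim_precomp ::
  "('o, 'a) cat \<Rightarrow> ('i, 'j, 'o, 'a) diagram \<Rightarrow> 'a \<Rightarrow> ('i \<times> 'a) set \<Rightarrow> ('i \<times> 'a) set" where
  "colim_precomp C E h A = colim_rel C (Dom C h) E `` {(k, f \<odot>\<^bsub>C\<^esub> h) | k f. (k, f) \<in> A}"

type_synonym ('i, 'j, 'o, 'a) ind_arrow =
  "('i, 'j, 'o, 'a) diagram \<times> ('i \<Rightarrow> ('i \<times> 'a) set) \<times> ('i, 'j, 'o, 'a) diagram"

definition ind_hom ::
  "('o, 'a) cat \<Rightarrow> ('i, 'j, 'o, 'a) diagram \<Rightarrow> ('i, 'j, 'o, 'a) diagram \<Rightarrow>
     ('i \<Rightarrow> ('i \<times> 'a) set) set" where
  "ind_hom C D E =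
     {\<alpha> \<in> (\<Pi>\<^sub>E i\<in>Obj (Index D). colim_hom C (Ob D i) E).
        \<forall>s\<in>Arr (Index D).
          \<alpha> (Dom (Index D) s) = colim_precomp C E (Ar D s) (\<alpha> (Cod (Index D) s))}"

definition Ind :: "('o, 'a) cat \<Rightarrow>
    (('i, 'j, 'o, 'a) diagram, ('i, 'j, 'o, 'a) ind_arrow) cat" where
  "Ind C =
     \<lparr>Obj = {D. filtered (Index D) \<and> cat_functor (Index D) C (Ob D) (Ar D)},
      Arr = {(D, \<alpha>, E) | D \<alpha> E.
               filtered (Index D) \<and> cat_functor (Index D) C (Ob D) (Ar D) \<and>
               filtered (Index E) \<and> cat_functor (Index E) C (Ob E) (Ar E) \<and>
               \<alpha> \<in> ind_hom C D E},
      Dom = (\<lambda>(D, \<alpha>, E). D),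
      Cod = (\<lambda>(D, \<alpha>, E). E),
      Ident = (\<lambda>D. (D, \<lambda>i\<in>Obj (Index D). colim_rel C (Ob D i) D `` {(i, Ident C (Ob D i))}, D)),
      Comp = (\<lambda>(D', \<beta>, E) (D, \<alpha>, _).
        (D, \<lambda>i\<in>Obj (Index D). colim_rel C (Ob D i) E ``
              {(l, g \<odot>\<^bsub>C\<^esub> f) | k f l g. (k, f) \<in> \<alpha> i \<and> (l, g) \<in> \<beta> k}, E))\<rparr>"

text \<open>
  The canonical embedding of C sends \<open>c\<close> to the diagram constantly \<open>c\<close> on the category with a
  single object and a single arrow.
\<close>

definition terminal_cat :: "('i, 'j) cat" where
  "terminal_cat = \<lparr>Obj = {undefined}, Arr = {undefined}, Dom = (\<lambda>_. undefined),
     Cod = (\<lambda>_. undefined), Ident = (\<lambda>_. undefined), Comp = (\<lambda>_ _. undefined)\<rparr>"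

definition emb :: "('o, 'a) cat \<Rightarrow> 'o \<Rightarrow> ('i, 'j, 'o, 'a) diagram" where
  "emb C c = \<lparr>Index = terminal_cat, Ob = (\<lambda>_. c), Ar = (\<lambda>_. Ident C c)\<rparr>"

definition emb_arr :: "('o, 'a) cat \<Rightarrow> 'a \<Rightarrow> ('i, 'j, 'o, 'a) ind_arrow" where
  "emb_arr C f =
     (emb C (Dom C f),
      \<lambda>i\<in>{undefined}.
        colim_rel C (Dom C f) (emb C (Cod C f) :: ('i, 'j, 'o, 'a) diagram) `` {(i, f)},
      emb C (Cod C f))"

definition universal_object :: "('o, 'a) cat \<Rightarrow> ('i, 'j, 'o, 'a) diagram \<Rightarrow> bool" where
  "universal_object C u \<longleftrightarrow> (\<forall>a\<in>Obj C. Homs (Ind C) (emb C a) u \<noteq> {})"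

definition ultrahomogeneous :: "('o, 'a) cat \<Rightarrow> ('i, 'j, 'o, 'a) diagram \<Rightarrow> bool" where
  "ultrahomogeneous C u \<longleftrightarrow>
     (\<forall>a\<in>Obj C. \<forall>b\<in>Obj C. \<forall>j\<in>Homs C a b.
      \<forall>\<chi>\<^sub>1\<in>Homs (Ind C) (emb C a) u. \<forall>\<chi>\<^sub>2\<in>Homs (Ind C) (emb C b) u.
        \<exists>j'\<in>Isos (Ind C) u u. j' \<odot>\<^bsub>Ind C\<^esub> \<chi>\<^sub>1 = \<chi>\<^sub>2 \<odot>\<^bsub>Ind C\<^esub> emb_arr C j)"


section \<open>The topological group of automorphisms\<close>

definition fixing :: "('o, 'a) cat \<Rightarrow> ('i, 'j, 'o, 'a) diagram \<Rightarrow>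
    ('i, 'j, 'o, 'a) ind_arrow \<Rightarrow> ('i, 'j, 'o, 'a) ind_arrow set" where
  "fixing C u \<chi> = {f \<in> Isos (Ind C) u u. f \<odot>\<^bsub>Ind C\<^esub> \<chi> = \<chi>}"

definition fixing_subgroups :: "('o, 'a) cat \<Rightarrow> ('i, 'j, 'o, 'a) diagram \<Rightarrow>
    ('i, 'j, 'o, 'a) ind_arrow set set" where
  "fixing_subgroups C u = {fixing C u \<chi> | c \<chi>. c \<in> Obj C \<and> \<chi> \<in> Homs (Ind C) (emb C c) u}"

definition Aut_topology :: "('o, 'a) cat \<Rightarrow> ('i, 'j, 'o, 'a) diagram \<Rightarrow>
    ('i, 'j, 'o, 'a) ind_arrow topology" where
  "Aut_topology C u = topology (\<lambda>U. U \<subseteq> carrier (Aut (Ind C) u) \<and>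
     (\<forall>g\<in>U. \<exists>H\<in>fixing_subgroups C u. g <#\<^bsub>Aut (Ind C) u\<^esub> H \<subseteq> U))"


section \<open>Continuous actions on discrete sets\<close>

text \<open>An action on \<open>E\<close> is a pair of \<open>E\<close> and an action homomorphism into the bijections of \<open>E\<close>.\<close>

type_synonym ('g, 'x) action = "'x set \<times> ('g \<Rightarrow> 'x \<Rightarrow> 'x)"

definition continuous_action :: "'g monoid \<Rightarrow> 'g topology \<Rightarrow> ('g, 'x) action \<Rightarrow> bool" where
  "continuous_action G T X \<longleftrightarrow>
     group_action G (fst X) (snd X) \<and>
     continuous_map (prod_topology T (discrete_topology (fst X))) (discrete_topology (fst X))
       (\<lambda>(g, x). snd X g x)"

definition equivariant_maps :: "'g monoid \<Rightarrow> ('g, 'x) action \<Rightarrow> ('g, 'y) action \<Rightarrow> ('x \<Rightarrow> 'y) set" where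
  "equivariant_maps G X Y =
     {m \<in> fst X \<rightarrow>\<^sub>E fst Y. \<forall>g\<in>carrier G. \<forall>x\<in>fst X. m (snd X g x) = snd Y g (m x)}"

definition isomorphic_actions :: "'g monoid \<Rightarrow> ('g, 'x) action \<Rightarrow> ('g, 'y) action \<Rightarrow> bool" where
  "isomorphic_actions G X Y \<longleftrightarrow> (\<exists>m\<in>equivariant_maps G X Y. bij_betw m (fst X) (fst Y))"

definition coset_action :: "'g monoid \<Rightarrow> 'g set \<Rightarrow> ('g, 'g set) action" where
  "coset_action G H = (lcosets\<^bsub>G\<^esub> H, \<lambda>g. \<lambda>K\<in>lcosets\<^bsub>G\<^esub> H. g <#\<^bsub>G\<^esub> K)"

definition Cont :: "'g monoid \<Rightarrow> 'g topology \<Rightarrow>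
    (('g, 'x) action, ('g, 'x) action \<times> ('x \<Rightarrow> 'x) \<times> ('g, 'x) action) cat" where
  "Cont G T =
     \<lparr>Obj = {X. continuous_action G T X},
      Arr = {(X, m, Y) | X m Y. continuous_action G T X \<and> continuous_action G T Y \<and>
               m \<in> equivariant_maps G X Y},
      Dom = (\<lambda>(X, m, Y). X),
      Cod = (\<lambda>(X, m, Y). Y),
      Ident = (\<lambda>X. (X, \<lambda>x\<in>fst X. x, X)),
      Comp = (\<lambda>(_, n, Z) (X, m, _). (X, compose (fst X) n m, Z))\<rparr>"

definition full_subcategory :: "('o, 'a) cat \<Rightarrow> ('o \<Rightarrow> bool) \<Rightarrow> ('o, 'a) cat" where
  "full_subcategory C P = C\<lparr>Obj := {a \<in> Obj C. P a}, Arr := {f \<in> Arr C. P (Dom C f) \<and> P (Cod C f)}\<rparr>"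

definition Cont_fixing :: "('o, 'a) cat \<Rightarrow> ('i, 'j, 'o, 'a) diagram \<Rightarrow>
    ((('i, 'j, 'o, 'a) ind_arrow, 'x) action,
     (('i, 'j, 'o, 'a) ind_arrow, 'x) action \<times> ('x \<Rightarrow> 'x) \<times>
     (('i, 'j, 'o, 'a) ind_arrow, 'x) action) cat" where
  "Cont_fixing C u =
     full_subcategory (Cont (Aut (Ind C) u) (Aut_topology C u))
       (\<lambda>X. \<exists>H\<in>fixing_subgroups C u.
          isomorphic_actions (Aut (Ind C) u) X (coset_action (Aut (Ind C) u) H))"

definition hom_action :: "('o, 'a) cat \<Rightarrow> ('i, 'j, 'o, 'a) diagram \<Rightarrow> 'o \<Rightarrow>
    (('i, 'j, 'o, 'a) ind_arrow, ('i, 'j, 'o, 'a) ind_arrow) action" where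
  "hom_action C u c =
     (Homs (Ind C) (emb C c) u, \<lambda>g. \<lambda>\<chi>\<in>Homs (Ind C) (emb C c) u. g \<odot>\<^bsub>Ind C\<^esub> \<chi>)"

text \<open>An arrow \<open>f : c \<rightarrow> d\<close> of C induces a map from the action at \<open>d\<close> to the action at \<open>c\<close>.\<close>

definition hom_action_arr :: "('o, 'a) cat \<Rightarrow> ('i, 'j, 'o, 'a) diagram \<Rightarrow> 'a \<Rightarrow>
    (('i, 'j, 'o, 'a) ind_arrow, ('i, 'j, 'o, 'a) ind_arrow) action \<times>
    (('i, 'j, 'o, 'a) ind_arrow \<Rightarrow> ('i, 'j, 'o, 'a) ind_arrow) \<times>
    (('i, 'j, 'o, 'a) ind_arrow, ('i, 'j, 'o, 'a) ind_arrow) action" where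
  "hom_action_arr C u f =
     (hom_action C u (Cod C f),
      \<lambda>\<xi>\<in>Homs (Ind C) (emb C (Cod C f)) u. \<xi> \<odot>\<^bsub>Ind C\<^esub> emb_arr C f,
      hom_action C u (Dom C f))"

end

theory Submission
  imports Defs
begin

text \<open>
  Call an arrow from an object of C to \<open>u\<close> a point of \<open>u\<close>. Since \<open>u\<close> is a filtered colimit, two points
  factor through a common one, and two arrows identified by a point are already identified by an arrow
  of C. Each of the three conditions is equivalent to the conjunction of two statements: points are
  monic, and a point \<open>\<chi>\<close> factors through every point \<open>\<xi>\<close> whose stabilizer lies in that of \<open>\<chi>\<close>. For the
  functor these two statements are faithfulness and fullness, because ultrahomogeneity makes the
  automorphism group act transitively on the points at each object, so that an equivariant map is
  determined by the image of one point.
\<close>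

section \<open>Categories\<close>

text \<open>Strictness speaks of pairs of arrows \<open>h\<close>, \<open>k\<close> out of one
  object, stabilizers speak of automorphisms of \<open>u\<close>; the proof translates between the
  two. Given a point \<open>p\<close> at the common domain and a point \<open>q\<close> at the
  common codomain, ultrahomogeneity yields automorphisms sending \<open>p\<close> to
  \<open>q h\<close> and to \<open>q k\<close>. Conversely, an automorphism \<open>s\<close> and a
  point \<open>p\<close> yield such a pair, because \<open>s p\<close> and \<open>p\<close> factor
  as \<open>q h\<close> and \<open>q k\<close> through a single point \<open>q\<close>. Either way
  an equation between points has to be brought back to an equation in \<open>C\<close>, and this is
  what monicity of points supplies; that is why it is split off as a statement of its own next to
  the factorization. The hom-sets of \<open>Ind C\<close> consist of families of equivalence
  classes, and composition collects the composites of all representatives, so a calculus of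
  representatives has to come before any of this.\<close>

lemma HomsD:
  assumes "f \<in> Homs C a b"
  shows "f \<in> Arr C" and "Dom C f = a" and "Cod C f = b"
  using assms by (auto simp: Homs_def)

lemma Homs_Dom_Cod: "f \<in> Arr C \<Longrightarrow> f \<in> Homs C (Dom C f) (Cod C f)"
  by (simp add: Homs_def)

context category
begin

lemma Homs_Obj:
  assumes "f \<in> Homs C a b"
  shows "a \<in> Obj C" and "b \<in> Obj C"
  using assms Dom_closed Cod_closed by (auto simp: Homs_def)

end

section \<open>Full subcategories, opposite categories and automorphism groups\<close>

lemma Homs_full_subcategory:
  "Homs (full_subcategory C P) a b = (if P a \<and> P b then Homs C a b else {})"
  by (auto simp: full_subcategory_def Homs_def)

lemma full_subcategory_simps:
  "Obj (full_subcategory C P) = {a \<in> Obj C. P a}"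
  "Ident (full_subcategory C P) = Ident C"
  "g \<odot>\<^bsub>full_subcategory C P\<^esub> f = g \<odot>\<^bsub>C\<^esub> f"
  by (simp_all add: full_subcategory_def)

lemma full_subcategory_category:
  assumes "category C"
  shows "category (full_subcategory C P)"
proof -
  interpret category C by fact
  show ?thesis
  proof (unfold_locales)
    show "f \<in> Arr (full_subcategory C P) \<Longrightarrow> Dom (full_subcategory C P) f \<in> Obj (full_subcategory C P)" for f
      by (auto simp: full_subcategory_def Dom_closed)
    show "f \<in> Arr (full_subcategory C P) \<Longrightarrow> Cod (full_subcategory C P) f \<in> Obj (full_subcategory C P)" for f
      by (auto simp: full_subcategory_def Cod_closed)
  qed (auto simp: Homs_full_subcategory full_subcategory_simps Ident_closed Comp_Ident Ident_Comp
      intro: Comp_closed Comp_assoc split: if_splits)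
qed

lemma Homs_opposite: "Homs (opposite C) a b = Homs C b a"
  by (auto simp: Homs_def opposite_def)

lemma opposite_simps:
  "Obj (opposite C) = Obj C" "Ident (opposite C) = Ident C" "g \<odot>\<^bsub>opposite C\<^esub> f = f \<odot>\<^bsub>C\<^esub> g"
  by (simp_all add: opposite_def)

lemma opposite_category:
  assumes "category C"
  shows "category (opposite C)"
proof -
  interpret category C by fact
  show ?thesis
  proof (unfold_locales)
    show "f \<in> Arr (opposite C) \<Longrightarrow> Dom (opposite C) f \<in> Obj (opposite C)" for f
      by (auto simp: opposite_def Cod_closed)
    show "f \<in> Arr (opposite C) \<Longrightarrow> Cod (opposite C) f \<in> Obj (opposite C)" for f
      by (auto simp: opposite_def Dom_closed)
  qed (auto simp: Homs_opposite opposite_simps Ident_closed Comp_Ident Ident_Comp Comp_assoc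
      intro: Comp_closed)
qed

text \<open>\<open>Isos\<close> and \<open>Aut\<close> are typed for records without extension, unlike the locale \<open>category\<close>.\<close>

locale bare_category = category C for C :: "('o, 'a) cat" (structure)
begin

lemma Isos_Homs: "f \<in> Isos C a b \<Longrightarrow> f \<in> Homs C a b"
  by (simp add: Isos_def)

lemma Isos_Comp:
  assumes f: "f \<in> Isos C a b" and g: "g \<in> Isos C b c"
  shows "g \<odot> f \<in> Isos C a c"
proof -
  obtain f' where f': "f' \<in> Homs C b a" "f' \<odot> f = Ident C a" "f \<odot> f' = Ident C b"
    using f by (auto simp: Isos_def)
  obtain g' where g': "g' \<in> Homs C c b" "g' \<odot> g = Ident C b" "g \<odot> g' = Ident C c"
    using g by (auto simp: Isos_def)
  have fh: "f \<in> Homs C a b" and gh: "g \<in> Homs C b c"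
    using f g by (auto simp: Isos_def)
  have "(f' \<odot> g') \<odot> (g \<odot> f) = f' \<odot> ((g' \<odot> g) \<odot> f)"
    using Comp_assoc[OF Comp_closed[OF fh gh] g'(1) f'(1)] Comp_assoc[OF fh gh g'(1)] by simp
  also have "\<dots> = Ident C a"
    using f' g' fh Ident_Comp by simp
  finally have 1: "(f' \<odot> g') \<odot> (g \<odot> f) = Ident C a" .
  have "(g \<odot> f) \<odot> (f' \<odot> g') = g \<odot> ((f \<odot> f') \<odot> g')"
    using Comp_assoc[OF Comp_closed[OF g'(1) f'(1)] fh gh] Comp_assoc[OF g'(1) f'(1) fh] by simp
  also have "\<dots> = Ident C c"
    using f' g' gh Ident_Comp by simp
  finally have 2: "(g \<odot> f) \<odot> (f' \<odot> g') = Ident C c" .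
  show ?thesis
    using 1 2 Comp_closed[OF fh gh] Comp_closed[OF g'(1) f'(1)] by (auto simp: Isos_def)
qed

lemma Ident_Isos: "a \<in> Obj C \<Longrightarrow> Ident C a \<in> Isos C a a"
  using Ident_closed Ident_Comp by (force simp: Isos_def)

lemma Aut_group:
  assumes "a \<in> Obj C"
  shows "group (Aut C a)"
proof (rule groupI)
  show "\<exists>y\<in>carrier (Aut C a). y \<otimes>\<^bsub>Aut C a\<^esub> x = \<one>\<^bsub>Aut C a\<^esub>" if "x \<in> carrier (Aut C a)" for x
    using that by (force simp: Aut_def Isos_def)
  show "x \<otimes>\<^bsub>Aut C a\<^esub> y \<otimes>\<^bsub>Aut C a\<^esub> z = x \<otimes>\<^bsub>Aut C a\<^esub> (y \<otimes>\<^bsub>Aut C a\<^esub> z)"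
    if "x \<in> carrier (Aut C a)" "y \<in> carrier (Aut C a)" "z \<in> carrier (Aut C a)" for x y z
    using that by (auto simp: Aut_def intro: Comp_assoc dest: Isos_Homs)
qed (use assms in \<open>auto simp: Aut_def Isos_Comp Ident_Isos intro: Ident_Comp dest: Isos_Homs\<close>)

end

section \<open>The category of continuous actions\<close>

lemma Homs_Cont:
  "f \<in> Homs (Cont G T) X Y \<longleftrightarrow>
     continuous_action G T X \<and> continuous_action G T Y \<and> (\<exists>m\<in>equivariant_maps G X Y. f = (X, m, Y))"
  by (cases X, cases Y) (auto simp: Homs_def Cont_def)

lemma Cont_category:
  fixes G :: "'g monoid"
  shows "category (Cont G T :: (('g, 'x) action, _) cat)"
proof
  show "f \<in> Arr (Cont G T) \<Longrightarrow> Dom (Cont G T) f \<in> Obj (Cont G T)"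
    for f :: "('g, 'x) action \<times> ('x \<Rightarrow> 'x) \<times> ('g, 'x) action"
    by (auto simp: Cont_def)
  show "f \<in> Arr (Cont G T) \<Longrightarrow> Cod (Cont G T) f \<in> Obj (Cont G T)"
    for f :: "('g, 'x) action \<times> ('x \<Rightarrow> 'x) \<times> ('g, 'x) action"
    by (auto simp: Cont_def)
  fix X :: "('g, 'x) action"
  assume "X \<in> Obj (Cont G T)"
  then have X: "continuous_action G T X" by (simp add: Cont_def)
  then have "snd X g x \<in> fst X" if "g \<in> carrier G" "x \<in> fst X" for g x
    using that group_action.element_image by (fastforce simp: continuous_action_def)
  then show "Ident (Cont G T) X \<in> Homs (Cont G T) X X"
    using X by (auto simp: Homs_Cont equivariant_maps_def) (auto simp: Cont_def)
next
  fix f g and X Y Z :: "('g, 'x) action"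
  assume "f \<in> Homs (Cont G T) X Y" "g \<in> Homs (Cont G T) Y Z"
  then obtain m n where m: "m \<in> equivariant_maps G X Y" "f = (X, m, Y)"
    and n: "n \<in> equivariant_maps G Y Z" "g = (Y, n, Z)"
    and cont: "continuous_action G T X" "continuous_action G T Z"
    by (auto simp: Homs_Cont)
  have act: "snd X g x \<in> fst X" if "g \<in> carrier G" "x \<in> fst X" for g x
    using that cont(1) group_action.element_image by (fastforce simp: continuous_action_def)
  have "compose (fst X) n m \<in> equivariant_maps G X Z"
    using m n act by (auto simp: equivariant_maps_def compose_def PiE_iff)
  then show "g \<odot>\<^bsub>Cont G T\<^esub> f \<in> Homs (Cont G T) X Z"
    using cont m n unfolding Homs_Cont by (auto simp: Cont_def)
next
  fix f and X Y :: "('g, 'x) action"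
  assume "f \<in> Homs (Cont G T) X Y"
  then obtain m where m: "m \<in> fst X \<rightarrow>\<^sub>E fst Y" "f = (X, m, Y)"
    by (auto simp: Homs_Cont equivariant_maps_def)
  have "compose (fst X) m (\<lambda>x\<in>fst X. x) = m" "compose (fst X) (\<lambda>y\<in>fst Y. y) m = m"
    using m by (auto simp: compose_def PiE_def extensional_def Pi_def fun_eq_iff)
  then show "f \<odot>\<^bsub>Cont G T\<^esub> Ident (Cont G T) X = f" "Ident (Cont G T) Y \<odot>\<^bsub>Cont G T\<^esub> f = f"
    using m by (auto simp: Cont_def)
next
  fix f g h and X Y Z W :: "('g, 'x) action"
  assume "f \<in> Homs (Cont G T) X Y" "g \<in> Homs (Cont G T) Y Z" "h \<in> Homs (Cont G T) Z W"
  then obtain k m n where "k \<in> fst X \<rightarrow>\<^sub>E fst Y" "f = (X, k, Y)"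
    and "g = (Y, m, Z)" and "h = (Z, n, W)"
    by (auto simp: Homs_Cont equivariant_maps_def)
  moreover from this have "compose (fst X) (compose (fst Y) n m) k = compose (fst X) n (compose (fst X) m k)"
    by (intro compose_assoc[symmetric]) (auto simp: PiE_iff)
  ultimately show "(h \<odot>\<^bsub>Cont G T\<^esub> g) \<odot>\<^bsub>Cont G T\<^esub> f = h \<odot>\<^bsub>Cont G T\<^esub> (g \<odot>\<^bsub>Cont G T\<^esub> f)"
    by (simp add: Cont_def)
qed


section \<open>Hom-sets into a filtered diagram\<close>

locale filtered_diagram =
  cat_functor "Index E" C "Ob E" "Ar E" for C :: "('o, 'a) cat" and E :: "('i, 'j, 'o, 'a) diagram" +
  assumes filtered_Index: "filtered (Index E)"

lemma Obj_Ind: "E \<in> Obj (Ind C) \<longleftrightarrow> filtered_diagram C E"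
  by (auto simp: Ind_def filtered_diagram_def filtered_diagram_axioms_def)

text \<open>The pair \<open>(k, f)\<close> stands for the composite of \<open>f\<close> with the
  colimit leg at stage \<open>k\<close>; all computations in \<open>Ind C\<close> below go through
  such representatives.\<close>

definition colim_class ::
  "('o, 'a) cat \<Rightarrow> 'o \<Rightarrow> ('i, 'j, 'o, 'a) diagram \<Rightarrow> 'i \<Rightarrow> 'a \<Rightarrow> ('i \<times> 'a) set" where
  "colim_class C c E k f = colim_rel C c E `` {(k, f)}"

context filtered_diagram
begin

abbreviation "J \<equiv> Index E"

lemma upper_bound:
  assumes "i \<in> Obj J" "j \<in> Obj J"
  obtains k s t where "s \<in> Homs J i k" "t \<in> Homs J j k"
  using assms filtered_Index unfolding filtered_def by blast

lemma coequalize: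
  assumes "s \<in> Homs J i j" "t \<in> Homs J i j"
  obtains k r where "r \<in> Homs J j k" "r \<odot>\<^bsub>J\<^esub> s = r \<odot>\<^bsub>J\<^esub> t"
  using assms filtered_Index source.Homs_Obj[OF assms(1)] unfolding filtered_def by blast

text \<open>An upper bound \<open>l\<close> of \<open>j\<close> and \<open>k\<close> gives two
  parallel composites out of \<open>i\<close>, and a further arrow \<open>r\<close> out of
  \<open>l\<close> equalizes them.\<close>

lemma complete_span:
  assumes s: "s \<in> Homs J i j" and t: "t \<in> Homs J i k"
  obtains m p q where "p \<in> Homs J j m" "q \<in> Homs J k m" "p \<odot>\<^bsub>J\<^esub> s = q \<odot>\<^bsub>J\<^esub> t"
proof -
  obtain l p q where pq: "p \<in> Homs J j l" "q \<in> Homs J k l"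
    using upper_bound[OF source.Homs_Obj(2)[OF s] source.Homs_Obj(2)[OF t]] by blast
  obtain m r where r: "r \<in> Homs J l m" "r \<odot>\<^bsub>J\<^esub> (p \<odot>\<^bsub>J\<^esub> s) = r \<odot>\<^bsub>J\<^esub> (q \<odot>\<^bsub>J\<^esub> t)"
    using coequalize[OF source.Comp_closed[OF s pq(1)] source.Comp_closed[OF t pq(2)]] by blast
  show thesis
  proof (rule that)
    show "r \<odot>\<^bsub>J\<^esub> p \<in> Homs J j m" "r \<odot>\<^bsub>J\<^esub> q \<in> Homs J k m"
      using source.Comp_closed r pq by auto
    show "(r \<odot>\<^bsub>J\<^esub> p) \<odot>\<^bsub>J\<^esub> s = (r \<odot>\<^bsub>J\<^esub> q) \<odot>\<^bsub>J\<^esub> t"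
      using r s t pq by (simp add: source.Comp_assoc)
  qed
qed

lemma Ar_Comp_assoc:
  assumes "f \<in> Homs C c (Ob E k)" "s \<in> Homs J k l" "p \<in> Homs J l m"
  shows "Ar E (p \<odot>\<^bsub>J\<^esub> s) \<odot>\<^bsub>C\<^esub> f = Ar E p \<odot>\<^bsub>C\<^esub> (Ar E s \<odot>\<^bsub>C\<^esub> f)"
  using target.Comp_assoc[OF assms(1) Fa_closed[OF assms(2)] Fa_closed[OF assms(3)]] Fa_Comp[OF assms(2,3)]
  by simp

lemma colim_relI:
  assumes "s \<in> Homs J k m" "t \<in> Homs J l m" "f \<in> Homs C c (Ob E k)" "g \<in> Homs C c (Ob E l)"
    and "Ar E s \<odot>\<^bsub>C\<^esub> f = Ar E t \<odot>\<^bsub>C\<^esub> g"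
  shows "((k, f), (l, g)) \<in> colim_rel C c E"
  using assms source.Homs_Obj unfolding colim_rel_def by blast

lemma colim_relE:
  assumes "((k, f), (l, g)) \<in> colim_rel C c E"
  obtains m s t where "s \<in> Homs J k m" "t \<in> Homs J l m" "f \<in> Homs C c (Ob E k)" "g \<in> Homs C c (Ob E l)"
    "Ar E s \<odot>\<^bsub>C\<^esub> f = Ar E t \<odot>\<^bsub>C\<^esub> g"
  using assms unfolding colim_rel_def by blast

lemma equiv_colim_rel: "equiv (SIGMA k : Obj J. Homs C c (Ob E k)) (colim_rel C c E)"
proof (rule equivI)
  show "colim_rel C c E \<subseteq> (SIGMA k : Obj J. Homs C c (Ob E k)) \<times> (SIGMA k : Obj J. Homs C c (Ob E k))"
    by (auto simp: colim_rel_def)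
  show "refl_on (SIGMA k : Obj J. Homs C c (Ob E k)) (colim_rel C c E)"
    by (auto simp: refl_on_def intro: colim_relI source.Ident_closed)
  show "sym (colim_rel C c E)"
    by (auto simp: sym_def elim!: colim_relE intro: colim_relI[OF _ _ _ _ sym])
  show "trans (colim_rel C c E)"
  proof (rule transI, clarify)
    fix k f l g n h
    assume "((k, f), (l, g)) \<in> colim_rel C c E" "((l, g), (n, h)) \<in> colim_rel C c E"
    then obtain m s t m' s' t' where
      s: "s \<in> Homs J k m" and t: "t \<in> Homs J l m" and s': "s' \<in> Homs J l m'" and t': "t' \<in> Homs J n m'"
      and f: "f \<in> Homs C c (Ob E k)" and g: "g \<in> Homs C c (Ob E l)" and h: "h \<in> Homs C c (Ob E n)"
      and eq: "Ar E s \<odot>\<^bsub>C\<^esub> f = Ar E t \<odot>\<^bsub>C\<^esub> g" and eq': "Ar E s' \<odot>\<^bsub>C\<^esub> g = Ar E t' \<odot>\<^bsub>C\<^esub> h"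
      by (elim colim_relE) blast
    \<comment> \<open>Both comparisons pass through the middle index \<open>l\<close>; completing
      the span \<open>t\<close>, \<open>s'\<close> out of it brings them to a common stage
      \<open>r\<close>.\<close>
    obtain r p q where p: "p \<in> Homs J m r" and q: "q \<in> Homs J m' r" and pq: "p \<odot>\<^bsub>J\<^esub> t = q \<odot>\<^bsub>J\<^esub> s'"
      using complete_span[OF t s'] by blast
    have "Ar E (p \<odot>\<^bsub>J\<^esub> s) \<odot>\<^bsub>C\<^esub> f = Ar E (p \<odot>\<^bsub>J\<^esub> t) \<odot>\<^bsub>C\<^esub> g"
      using Ar_Comp_assoc[OF f s p] Ar_Comp_assoc[OF g t p] eq by simp
    also have "\<dots> = Ar E (q \<odot>\<^bsub>J\<^esub> t') \<odot>\<^bsub>C\<^esub> h"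
      using Ar_Comp_assoc[OF g s' q] Ar_Comp_assoc[OF h t' q] eq' pq by simp
    finally have "Ar E (p \<odot>\<^bsub>J\<^esub> s) \<odot>\<^bsub>C\<^esub> f = Ar E (q \<odot>\<^bsub>J\<^esub> t') \<odot>\<^bsub>C\<^esub> h" .
    then show "((k, f), (n, h)) \<in> colim_rel C c E"
      using colim_relI[OF source.Comp_closed[OF s p] source.Comp_closed[OF t' q] f h] by simp
  qed
qed

lemma colim_class_eq_iff:
  assumes "k \<in> Obj J" "f \<in> Homs C c (Ob E k)" "l \<in> Obj J" "g \<in> Homs C c (Ob E l)"
  shows "colim_class C c E k f = colim_class C c E l g \<longleftrightarrow>
    (\<exists>m. \<exists>s\<in>Homs J k m. \<exists>t\<in>Homs J l m. Ar E s \<odot>\<^bsub>C\<^esub> f = Ar E t \<odot>\<^bsub>C\<^esub> g)"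
proof -
  have "colim_class C c E k f = colim_class C c E l g \<longleftrightarrow> ((k, f), (l, g)) \<in> colim_rel C c E"
    unfolding colim_class_def
    using assms by (intro eq_equiv_class_iff[OF equiv_colim_rel]) auto
  also have "\<dots> \<longleftrightarrow> (\<exists>m. \<exists>s\<in>Homs J k m. \<exists>t\<in>Homs J l m. Ar E s \<odot>\<^bsub>C\<^esub> f = Ar E t \<odot>\<^bsub>C\<^esub> g)"
    using assms by (auto elim!: colim_relE intro: colim_relI)
  finally show ?thesis .
qed

lemma colim_class_in: "\<lbrakk>k \<in> Obj J; f \<in> Homs C c (Ob E k)\<rbrakk> \<Longrightarrow> colim_class C c E k f \<in> colim_hom C c E"
  unfolding colim_class_def colim_hom_def by (intro quotientI) auto

lemma colim_class_self: "\<lbrakk>k \<in> Obj J; f \<in> Homs C c (Ob E k)\<rbrakk> \<Longrightarrow> (k, f) \<in> colim_class C c E k f"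
  unfolding colim_class_def by (intro equiv_class_self[OF equiv_colim_rel]) auto

lemma colim_homE:
  assumes "A \<in> colim_hom C c E"
  obtains k f where "k \<in> Obj J" "f \<in> Homs C c (Ob E k)" "A = colim_class C c E k f"
  using assms unfolding colim_hom_def colim_class_def by (auto elim!: quotientE)

lemma colim_class_memD:
  assumes "(l, g) \<in> colim_class C c E k f"
  shows "l \<in> Obj J" and "g \<in> Homs C c (Ob E l)" and "colim_class C c E l g = colim_class C c E k f"
proof -
  have rel: "((k, f), (l, g)) \<in> colim_rel C c E"
    using assms by (simp add: colim_class_def)
  then show "l \<in> Obj J" "g \<in> Homs C c (Ob E l)"
    by (auto simp: colim_rel_def)
  show "colim_class C c E l g = colim_class C c E k f"
    unfolding colim_class_def using equiv_class_eq[OF equiv_colim_rel rel] by simp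
qed

text \<open>The two representatives are compared at stage \<open>l\<close> itself, along the
  identity on one side and \<open>s\<close> on the other.\<close>

lemma colim_class_push:
  assumes "s \<in> Homs J k l" "f \<in> Homs C c (Ob E k)"
  shows "colim_class C c E l (Ar E s \<odot>\<^bsub>C\<^esub> f) = colim_class C c E k f"
proof -
  have l: "l \<in> Obj J" "k \<in> Obj J" using assms source.Homs_Obj by auto
  have sf: "Ar E s \<odot>\<^bsub>C\<^esub> f \<in> Homs C c (Ob E l)"
    using assms Fa_closed target.Comp_closed by blast
  have "Ar E (Ident J l) \<odot>\<^bsub>C\<^esub> (Ar E s \<odot>\<^bsub>C\<^esub> f) = Ar E s \<odot>\<^bsub>C\<^esub> f"
    using l sf by (simp add: Fa_Ident target.Ident_Comp)
  then show ?thesis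
    using assms l sf source.Ident_closed[OF l(1)] by (subst colim_class_eq_iff) blast+
qed

text \<open>The image of a set under \<open>colim_rel\<close> is the union of the classes of its
  members. Operations defined by such an image are therefore well defined as soon as all members of
  the set lie in one class and there is at least one.\<close>

lemma colim_class_unique:
  assumes "\<And>l g. (l, g) \<in> S \<Longrightarrow> l \<in> Obj J \<and> g \<in> Homs C c (Ob E l) \<and> colim_class C c E l g = A"
    and "S \<noteq> {}"
  shows "colim_rel C c E `` S = A"
proof -
  have "colim_rel C c E `` S = (\<Union>(l, g)\<in>S. colim_class C c E l g)"
    by (auto simp: colim_class_def)
  also have "\<dots> = A" using assms by fastforce
  finally show ?thesis .
qed

lemma colim_class_cong_precomp:
  assumes "k \<in> Obj J" "f \<in> Homs C c (Ob E k)" "l \<in> Obj J" "g \<in> Homs C c (Ob E l)" "h \<in> Homs C d c"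
    and "colim_class C c E k f = colim_class C c E l g"
  shows "colim_class C d E k (f \<odot>\<^bsub>C\<^esub> h) = colim_class C d E l (g \<odot>\<^bsub>C\<^esub> h)"
proof -
  obtain m s t where st: "s \<in> Homs J k m" "t \<in> Homs J l m" "Ar E s \<odot>\<^bsub>C\<^esub> f = Ar E t \<odot>\<^bsub>C\<^esub> g"
    using assms colim_class_eq_iff by blast
  have "Ar E s \<odot>\<^bsub>C\<^esub> (f \<odot>\<^bsub>C\<^esub> h) = Ar E t \<odot>\<^bsub>C\<^esub> (g \<odot>\<^bsub>C\<^esub> h)"
    using target.Comp_assoc[OF assms(5,2) Fa_closed[OF st(1)]]
      target.Comp_assoc[OF assms(5,4) Fa_closed[OF st(2)]] st(3) by simp
  then show ?thesis
    using assms st by (subst colim_class_eq_iff) (blast intro: target.Comp_closed)+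
qed

lemma colim_precomp_class:
  assumes k: "k \<in> Obj J" and f: "f \<in> Homs C c (Ob E k)" and h: "h \<in> Homs C d c"
  shows "colim_precomp C E h (colim_class C c E k f) = colim_class C d E k (f \<odot>\<^bsub>C\<^esub> h)"
proof -
  have "Dom C h = d" using h by (rule HomsD)
  show ?thesis
    unfolding colim_precomp_def \<open>Dom C h = d\<close>
  proof (rule colim_class_unique)
    show "{(k', f' \<odot>\<^bsub>C\<^esub> h) |k' f'. (k', f') \<in> colim_class C c E k f} \<noteq> {}"
      using colim_class_self[OF k f] by blast
    fix l g
    assume "(l, g) \<in> {(k', f' \<odot>\<^bsub>C\<^esub> h) |k' f'. (k', f') \<in> colim_class C c E k f}"
    then obtain f' where g: "g = f' \<odot>\<^bsub>C\<^esub> h" and f': "(l, f') \<in> colim_class C c E k f"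
      by blast
    note f'D = colim_class_memD[OF f']
    show "l \<in> Obj J \<and> g \<in> Homs C d (Ob E l) \<and> colim_class C d E l g = colim_class C d E k (f \<odot>\<^bsub>C\<^esub> h)"
      using f'D(1) target.Comp_closed[OF h f'D(2)] colim_class_cong_precomp[OF f'D(1,2) k f h f'D(3)] g
      by simp
  qed
qed

end


section \<open>The ind-completion as a category\<close>

lemma ind_homD:
  assumes "\<alpha> \<in> ind_hom C D E"
  shows "i \<in> Obj (Index D) \<Longrightarrow> \<alpha> i \<in> colim_hom C (Ob D i) E"
    and "\<alpha> \<in> extensional (Obj (Index D))"
    and "s \<in> Homs (Index D) i j \<Longrightarrow> \<alpha> i = colim_precomp C E (Ar D s) (\<alpha> j)"
  using assms by (auto simp: ind_hom_def Homs_def PiE_iff)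

lemma ind_homI:
  assumes "\<And>i. i \<in> Obj (Index D) \<Longrightarrow> \<alpha> i \<in> colim_hom C (Ob D i) E"
    and "\<alpha> \<in> extensional (Obj (Index D))"
    and "\<And>s i j. s \<in> Homs (Index D) i j \<Longrightarrow> \<alpha> i = colim_precomp C E (Ar D s) (\<alpha> j)"
  shows "\<alpha> \<in> ind_hom C D E"
  using assms(1,2) assms(3)[OF Homs_Dom_Cod] by (simp add: ind_hom_def PiE_iff)

lemma ind_hom_eqI:
  assumes "\<alpha> \<in> ind_hom C D E" "\<beta> \<in> ind_hom C D E" "\<And>i. i \<in> Obj (Index D) \<Longrightarrow> \<alpha> i = \<beta> i"
  shows "\<alpha> = \<beta>"
  using extensionalityI[OF ind_homD(2)[OF assms(1)] ind_homD(2)[OF assms(2)]] assms(3) .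

lemma ind_hom_classE:
  assumes "filtered_diagram C E" "\<alpha> \<in> ind_hom C D E" "i \<in> Obj (Index D)"
  obtains k f where "k \<in> Obj (Index E)" "f \<in> Homs C (Ob D i) (Ob E k)"
    "\<alpha> i = colim_class C (Ob D i) E k f"
  using filtered_diagram.colim_homE[OF assms(1) ind_homD(1)[OF assms(2,3)]] by blast

text \<open>The family underlying a composite in \<open>Ind C\<close>, isolated so that the category
  laws become statements about families alone.\<close>

definition ind_comp ::
  "('o, 'a) cat \<Rightarrow> ('i, 'j, 'o, 'a) diagram \<Rightarrow> ('i, 'j, 'o, 'a) diagram \<Rightarrow>
     ('i \<Rightarrow> ('i \<times> 'a) set) \<Rightarrow> ('i \<Rightarrow> ('i \<times> 'a) set) \<Rightarrow> 'i \<Rightarrow> ('i \<times> 'a) set" where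
  "ind_comp C D F \<beta> \<alpha> =
     (\<lambda>i\<in>Obj (Index D). colim_rel C (Ob D i) F ``
        {(l, g \<odot>\<^bsub>C\<^esub> f) | k f l g. (k, f) \<in> \<alpha> i \<and> (l, g) \<in> \<beta> k})"

definition ind_id :: "('o, 'a) cat \<Rightarrow> ('i, 'j, 'o, 'a) diagram \<Rightarrow> 'i \<Rightarrow> ('i \<times> 'a) set" where
  "ind_id C D = (\<lambda>i\<in>Obj (Index D). colim_class C (Ob D i) D i (Ident C (Ob D i)))"

lemma Ind_simps:
  "(E', \<beta>, F) \<odot>\<^bsub>Ind C\<^esub> (D, \<alpha>, E) = (D, ind_comp C D F \<beta> \<alpha>, F)"
  "Ident (Ind C) D = (D, ind_id C D, D)"
  by (simp_all add: Ind_def ind_comp_def ind_id_def colim_class_def)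

lemma Homs_Ind:
  "f \<in> Homs (Ind C) D E \<longleftrightarrow>
     filtered_diagram C D \<and> filtered_diagram C E \<and> (\<exists>\<alpha>\<in>ind_hom C D E. f = (D, \<alpha>, E))"
  by (auto simp: Homs_def Ind_def filtered_diagram_def filtered_diagram_axioms_def)

text \<open>Independence of the representatives: \<open>f\<close> and \<open>f'\<close> agree at a
  later stage \<open>m\<close>, and compatibility of \<open>\<beta>\<close> with the arrows into
  \<open>m\<close> rewrites \<open>g\<close> and \<open>g'\<close> in terms of one representative
  \<open>p\<close> of \<open>\<beta> m\<close>. Both composites then represent \<open>p\<close>
  after the same arrow.\<close>

lemma ind_comp_class_cong:
  assumes E: "filtered_diagram C E" and F: "filtered_diagram C F" and \<beta>: "\<beta> \<in> ind_hom C E F"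
    and k: "k \<in> Obj (Index E)" "f \<in> Homs C c (Ob E k)"
    and k': "k' \<in> Obj (Index E)" "f' \<in> Homs C c (Ob E k')"
    and l: "l \<in> Obj (Index F)" "g \<in> Homs C (Ob E k) (Ob F l)" "\<beta> k = colim_class C (Ob E k) F l g"
    and l': "l' \<in> Obj (Index F)" "g' \<in> Homs C (Ob E k') (Ob F l')" "\<beta> k' = colim_class C (Ob E k') F l' g'"
    and eq: "colim_class C c E k f = colim_class C c E k' f'"
  shows "colim_class C c F l (g \<odot>\<^bsub>C\<^esub> f) = colim_class C c F l' (g' \<odot>\<^bsub>C\<^esub> f')"
proof -
  interpret E: filtered_diagram C E by fact
  interpret F: filtered_diagram C F by fact
  obtain m s s' where s: "s \<in> Homs (Index E) k m" and s': "s' \<in> Homs (Index E) k' m"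
    and ss: "Ar E s \<odot>\<^bsub>C\<^esub> f = Ar E s' \<odot>\<^bsub>C\<^esub> f'"
    using E.colim_class_eq_iff[OF k k'] eq by blast
  obtain n p where n: "n \<in> Obj (Index F)" "p \<in> Homs C (Ob E m) (Ob F n)" "\<beta> m = colim_class C (Ob E m) F n p"
    using ind_hom_classE[OF F \<beta> E.source.Homs_Obj(2)[OF s]] by blast
  \<comment> \<open>Stated for an arbitrary index with an arrow to \<open>m\<close>, as it serves
    for \<open>k\<close> and for \<open>k'\<close>.\<close>
  have pushed: "colim_class C c F l (g \<odot>\<^bsub>C\<^esub> f) = colim_class C c F n (p \<odot>\<^bsub>C\<^esub> (Ar E s \<odot>\<^bsub>C\<^esub> f))"
    if s: "s \<in> Homs (Index E) k m" and f: "f \<in> Homs C c (Ob E k)" and "l \<in> Obj (Index F)"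
      and g: "g \<in> Homs C (Ob E k) (Ob F l)" and "\<beta> k = colim_class C (Ob E k) F l g" for s f k l g
  proof -
    have As: "Ar E s \<in> Homs C (Ob E k) (Ob E m)"
      using s by (rule E.Fa_closed)
    have "colim_class C (Ob E k) F l g = colim_class C (Ob E k) F n (p \<odot>\<^bsub>C\<^esub> Ar E s)"
      using ind_homD(3)[OF \<beta> s] F.colim_precomp_class[OF n(1,2) As] that n by simp
    then have "colim_class C c F l (g \<odot>\<^bsub>C\<^esub> f) = colim_class C c F n ((p \<odot>\<^bsub>C\<^esub> Ar E s) \<odot>\<^bsub>C\<^esub> f)"
      using that n E.target.Comp_closed[OF As n(2)] by (intro F.colim_class_cong_precomp[OF _ g _ _ f])
    then show ?thesis
      using E.target.Comp_assoc[OF f As n(2)] by simp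
  qed
  show ?thesis
    using pushed[OF s k(2) l] pushed[OF s' k'(2) l'] ss by simp
qed

text \<open>The computation rule for composites: any choice of representatives may be used. It
  reduces closure, units and associativity in \<open>Ind C\<close> to the corresponding laws of
  \<open>C\<close>.\<close>

lemma ind_comp_class:
  assumes E: "filtered_diagram C E" and F: "filtered_diagram C F" and \<beta>: "\<beta> \<in> ind_hom C E F"
    and i: "i \<in> Obj (Index D)"
    and k: "k \<in> Obj (Index E)" "f \<in> Homs C (Ob D i) (Ob E k)" "\<alpha> i = colim_class C (Ob D i) E k f"
    and l: "l \<in> Obj (Index F)" "g \<in> Homs C (Ob E k) (Ob F l)" "\<beta> k = colim_class C (Ob E k) F l g"
  shows "ind_comp C D F \<beta> \<alpha> i = colim_class C (Ob D i) F l (g \<odot>\<^bsub>C\<^esub> f)"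
proof -
  interpret E: filtered_diagram C E by fact
  interpret F: filtered_diagram C F by fact
  have "colim_rel C (Ob D i) F `` {(l, g \<odot>\<^bsub>C\<^esub> f) | k f l g. (k, f) \<in> \<alpha> i \<and> (l, g) \<in> \<beta> k} =
    colim_class C (Ob D i) F l (g \<odot>\<^bsub>C\<^esub> f)"
  proof (rule F.colim_class_unique)
    show "{(l, g \<odot>\<^bsub>C\<^esub> f) | k f l g. (k, f) \<in> \<alpha> i \<and> (l, g) \<in> \<beta> k} \<noteq> {}"
      using E.colim_class_self[OF k(1,2)] F.colim_class_self[OF l(1,2)] k(3) l(3) by blast
    fix l' h
    assume "(l', h) \<in> {(l, g \<odot>\<^bsub>C\<^esub> f) | k f l g. (k, f) \<in> \<alpha> i \<and> (l, g) \<in> \<beta> k}"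
    then obtain k' f' g' where h: "h = g' \<odot>\<^bsub>C\<^esub> f'" and kf: "(k', f') \<in> \<alpha> i" and lg: "(l', g') \<in> \<beta> k'"
      by blast
    note f' = E.colim_class_memD[OF kf[unfolded k(3)]]
    have "\<beta> k' \<in> colim_hom C (Ob E k') F"
      using ind_homD(1)[OF \<beta> f'(1)] .
    then obtain l'' g'' where "\<beta> k' = colim_class C (Ob E k') F l'' g''"
      by (rule F.colim_homE)
    with lg have g': "l' \<in> Obj (Index F)" "g' \<in> Homs C (Ob E k') (Ob F l')"
      "\<beta> k' = colim_class C (Ob E k') F l' g'"
      using F.colim_class_memD by auto
    show "l' \<in> Obj (Index F) \<and> h \<in> Homs C (Ob D i) (Ob F l') \<and>
        colim_class C (Ob D i) F l' h = colim_class C (Ob D i) F l (g \<odot>\<^bsub>C\<^esub> f)"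
      using ind_comp_class_cong[OF E F \<beta> f'(1,2) k(1,2) g' l f'(3)] g' E.target.Comp_closed[OF f'(2) g'(2)] h
      by simp
  qed
  then show ?thesis
    using i by (simp add: ind_comp_def)
qed

lemma ind_comp_closed:
  assumes D: "filtered_diagram C D" and E: "filtered_diagram C E" and F: "filtered_diagram C F"
    and \<alpha>: "\<alpha> \<in> ind_hom C D E" and \<beta>: "\<beta> \<in> ind_hom C E F"
  shows "ind_comp C D F \<beta> \<alpha> \<in> ind_hom C D F"
proof (rule ind_homI)
  interpret D: filtered_diagram C D by fact
  interpret E: filtered_diagram C E by fact
  interpret F: filtered_diagram C F by fact
  show "ind_comp C D F \<beta> \<alpha> \<in> extensional (Obj (Index D))"
    by (simp add: ind_comp_def)
  show "ind_comp C D F \<beta> \<alpha> i \<in> colim_hom C (Ob D i) F" if i: "i \<in> Obj (Index D)" for i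
  proof -
    obtain k f where k: "k \<in> Obj (Index E)" "f \<in> Homs C (Ob D i) (Ob E k)" "\<alpha> i = colim_class C (Ob D i) E k f"
      using ind_hom_classE[OF E \<alpha> i] .
    obtain l g where l: "l \<in> Obj (Index F)" "g \<in> Homs C (Ob E k) (Ob F l)" "\<beta> k = colim_class C (Ob E k) F l g"
      using ind_hom_classE[OF F \<beta> k(1)] .
    show ?thesis
      using ind_comp_class[where \<alpha> = \<alpha>, OF E F \<beta> i k l] F.colim_class_in[OF l(1) D.target.Comp_closed[OF k(2) l(2)]]
      by simp
  qed
  show "ind_comp C D F \<beta> \<alpha> i = colim_precomp C F (Ar D s) (ind_comp C D F \<beta> \<alpha> j)"
    if s: "s \<in> Homs (Index D) i j" for s i j
  proof -
    have i: "i \<in> Obj (Index D)" and j: "j \<in> Obj (Index D)"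
      using D.source.Homs_Obj[OF s] by auto
    have As: "Ar D s \<in> Homs C (Ob D i) (Ob D j)"
      using s by (rule D.Fa_closed)
    obtain k f where k: "k \<in> Obj (Index E)" "f \<in> Homs C (Ob D j) (Ob E k)" "\<alpha> j = colim_class C (Ob D j) E k f"
      using ind_hom_classE[OF E \<alpha> j] .
    obtain l g where l: "l \<in> Obj (Index F)" "g \<in> Homs C (Ob E k) (Ob F l)" "\<beta> k = colim_class C (Ob E k) F l g"
      using ind_hom_classE[OF F \<beta> k(1)] .
    have "\<alpha> i = colim_class C (Ob D i) E k (f \<odot>\<^bsub>C\<^esub> Ar D s)"
      using ind_homD(3)[OF \<alpha> s] E.colim_precomp_class[OF k(1,2) As] k(3) by simp
    then have "ind_comp C D F \<beta> \<alpha> i = colim_class C (Ob D i) F l (g \<odot>\<^bsub>C\<^esub> (f \<odot>\<^bsub>C\<^esub> Ar D s))"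
      by (intro ind_comp_class[OF E F \<beta> i k(1) D.target.Comp_closed[OF As k(2)] _ l])
    also have "\<dots> = colim_precomp C F (Ar D s) (colim_class C (Ob D j) F l (g \<odot>\<^bsub>C\<^esub> f))"
      using F.colim_precomp_class[OF l(1) D.target.Comp_closed[OF k(2) l(2)] As] D.target.Comp_assoc[OF As k(2) l(2)]
      by simp
    also have "colim_class C (Ob D j) F l (g \<odot>\<^bsub>C\<^esub> f) = ind_comp C D F \<beta> \<alpha> j"
      using ind_comp_class[where \<alpha> = \<alpha>, OF E F \<beta> j k l] by simp
    finally show ?thesis .
  qed
qed

lemma ind_id_in:
  assumes "filtered_diagram C D"
  shows "ind_id C D \<in> ind_hom C D D"
proof (rule ind_homI)
  interpret D: filtered_diagram C D by fact
  show "ind_id C D \<in> extensional (Obj (Index D))"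
    by (simp add: ind_id_def)
  show "ind_id C D i \<in> colim_hom C (Ob D i) D" if "i \<in> Obj (Index D)" for i
    using that by (auto simp: ind_id_def intro: D.colim_class_in D.target.Ident_closed D.Fo_closed)
  show "ind_id C D i = colim_precomp C D (Ar D s) (ind_id C D j)" if s: "s \<in> Homs (Index D) i j" for s i j
  proof -
    have i: "i \<in> Obj (Index D)" and j: "j \<in> Obj (Index D)"
      using D.source.Homs_Obj[OF s] by auto
    note idi = D.target.Ident_closed[OF D.Fo_closed[OF i]]
    note idj = D.target.Ident_closed[OF D.Fo_closed[OF j]]
    note As = D.Fa_closed[OF s]
    have "colim_precomp C D (Ar D s) (ind_id C D j) = colim_class C (Ob D i) D j (Ar D s \<odot>\<^bsub>C\<^esub> Ident C (Ob D i))"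
      using D.colim_precomp_class[OF j idj As] j D.target.Comp_Ident[OF As] D.target.Ident_Comp[OF As]
      by (simp add: ind_id_def)
    also have "\<dots> = ind_id C D i"
      using D.colim_class_push[OF s idi] i by (simp add: ind_id_def)
    finally show ?thesis by simp
  qed
qed

lemma ind_comp_ind_id:
  assumes D: "filtered_diagram C D" and E: "filtered_diagram C E" and \<alpha>: "\<alpha> \<in> ind_hom C D E"
  shows "ind_comp C D E \<alpha> (ind_id C D) = \<alpha>" and "ind_comp C D E (ind_id C E) \<alpha> = \<alpha>"
proof -
  interpret D: filtered_diagram C D by fact
  interpret E: filtered_diagram C E by fact
  have *: "ind_comp C D E \<alpha> (ind_id C D) i = \<alpha> i \<and> ind_comp C D E (ind_id C E) \<alpha> i = \<alpha> i"
    if i: "i \<in> Obj (Index D)" for i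
  proof -
    obtain k f where k: "k \<in> Obj (Index E)" "f \<in> Homs C (Ob D i) (Ob E k)" "\<alpha> i = colim_class C (Ob D i) E k f"
      using ind_hom_classE[OF E \<alpha> i] .
    note idi = D.target.Ident_closed[OF D.Fo_closed[OF i]]
    note idk = D.target.Ident_closed[OF E.Fo_closed[OF k(1)]]
    have "ind_comp C D E \<alpha> (ind_id C D) i = colim_class C (Ob D i) E k (f \<odot>\<^bsub>C\<^esub> Ident C (Ob D i))"
      using i by (intro ind_comp_class[OF D E \<alpha> i i idi _ k]) (simp add: ind_id_def)
    moreover have "ind_comp C D E (ind_id C E) \<alpha> i = colim_class C (Ob D i) E k (Ident C (Ob E k) \<odot>\<^bsub>C\<^esub> f)"
      using k(1) by (intro ind_comp_class[where \<alpha> = \<alpha>, OF E E ind_id_in[OF E] i k k(1) idk]) (simp add: ind_id_def)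
    ultimately show ?thesis
      using D.target.Comp_Ident[OF k(2)] D.target.Ident_Comp[OF k(2)] k(3) by simp
  qed
  show "ind_comp C D E \<alpha> (ind_id C D) = \<alpha>"
    using * by (intro ind_hom_eqI[OF ind_comp_closed[OF D D E ind_id_in[OF D] \<alpha>] \<alpha>]) simp
  show "ind_comp C D E (ind_id C E) \<alpha> = \<alpha>"
    using * by (intro ind_hom_eqI[OF ind_comp_closed[OF D E E \<alpha> ind_id_in[OF E]] \<alpha>]) simp
qed

lemma ind_comp_assoc:
  assumes D: "filtered_diagram C D" and E: "filtered_diagram C E"
    and F: "filtered_diagram C F" and G: "filtered_diagram C G"
    and \<alpha>: "\<alpha> \<in> ind_hom C D E" and \<beta>: "\<beta> \<in> ind_hom C E F" and \<gamma>: "\<gamma> \<in> ind_hom C F G"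
  shows "ind_comp C D G (ind_comp C E G \<gamma> \<beta>) \<alpha> = ind_comp C D G \<gamma> (ind_comp C D F \<beta> \<alpha>)"
proof (rule ind_hom_eqI)
  interpret G: filtered_diagram C G by fact
  note \<beta>\<alpha> = ind_comp_closed[OF D E F \<alpha> \<beta>] and \<gamma>\<beta> = ind_comp_closed[OF E F G \<beta> \<gamma>]
  show "ind_comp C D G (ind_comp C E G \<gamma> \<beta>) \<alpha> \<in> ind_hom C D G"
    by (rule ind_comp_closed[OF D E G \<alpha> \<gamma>\<beta>])
  show "ind_comp C D G \<gamma> (ind_comp C D F \<beta> \<alpha>) \<in> ind_hom C D G"
    by (rule ind_comp_closed[OF D F G \<beta>\<alpha> \<gamma>])
  fix i assume i: "i \<in> Obj (Index D)"
  obtain k f where k: "k \<in> Obj (Index E)" "f \<in> Homs C (Ob D i) (Ob E k)" "\<alpha> i = colim_class C (Ob D i) E k f"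
    using ind_hom_classE[OF E \<alpha> i] .
  obtain l g where l: "l \<in> Obj (Index F)" "g \<in> Homs C (Ob E k) (Ob F l)" "\<beta> k = colim_class C (Ob E k) F l g"
    using ind_hom_classE[OF F \<beta> k(1)] .
  obtain m h where m: "m \<in> Obj (Index G)" "h \<in> Homs C (Ob F l) (Ob G m)" "\<gamma> l = colim_class C (Ob F l) G m h"
    using ind_hom_classE[OF G \<gamma> l(1)] .
  have "ind_comp C E G \<gamma> \<beta> k = colim_class C (Ob E k) G m (h \<odot>\<^bsub>C\<^esub> g)"
    by (rule ind_comp_class[where \<alpha> = \<beta>, OF F G \<gamma> k(1) l m])
  then have 1: "ind_comp C D G (ind_comp C E G \<gamma> \<beta>) \<alpha> i = colim_class C (Ob D i) G m ((h \<odot>\<^bsub>C\<^esub> g) \<odot>\<^bsub>C\<^esub> f)"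
    by (rule ind_comp_class[where \<alpha> = \<alpha>, OF E G \<gamma>\<beta> i k m(1) G.target.Comp_closed[OF l(2) m(2)]])
  have "ind_comp C D F \<beta> \<alpha> i = colim_class C (Ob D i) F l (g \<odot>\<^bsub>C\<^esub> f)"
    by (rule ind_comp_class[where \<alpha> = \<alpha>, OF E F \<beta> i k l])
  then have 2: "ind_comp C D G \<gamma> (ind_comp C D F \<beta> \<alpha>) i = colim_class C (Ob D i) G m (h \<odot>\<^bsub>C\<^esub> (g \<odot>\<^bsub>C\<^esub> f))"
    by (rule ind_comp_class[OF F G \<gamma> i l(1) G.target.Comp_closed[OF k(2) l(2)] _ m])
  show "ind_comp C D G (ind_comp C E G \<gamma> \<beta>) \<alpha> i = ind_comp C D G \<gamma> (ind_comp C D F \<beta> \<alpha>) i"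
    using 1 2 G.target.Comp_assoc[OF k(2) l(2) m(2)] by simp
qed

text \<open>The category laws of \<open>C\<close> enter through the diagrams, each of which is a
  functor into \<open>C\<close>.\<close>

lemma Ind_category: "bare_category (Ind C :: (('i, 'j, 'o, 'a) diagram, _) cat)"
proof (unfold_locales)
  show "f \<in> Arr (Ind C) \<Longrightarrow> Dom (Ind C) f \<in> Obj (Ind C)" for f :: "('i, 'j, 'o, 'a) ind_arrow"
    by (auto simp: Ind_def)
  show "f \<in> Arr (Ind C) \<Longrightarrow> Cod (Ind C) f \<in> Obj (Ind C)" for f :: "('i, 'j, 'o, 'a) ind_arrow"
    by (auto simp: Ind_def)
qed (auto simp: Obj_Ind Homs_Ind Ind_simps ind_id_in ind_comp_closed ind_comp_ind_id ind_comp_assoc)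


section \<open>Arrows from objects of the base category\<close>

lemma terminal_cat_simps:
  "Obj terminal_cat = {undefined}" "Arr terminal_cat = {undefined}" "Ident terminal_cat i = undefined"
  "g \<odot>\<^bsub>terminal_cat\<^esub> f = undefined"
  by (simp_all add: terminal_cat_def)

lemma Homs_terminal_cat: "f \<in> Homs terminal_cat i j \<longleftrightarrow> f = undefined \<and> i = undefined \<and> j = undefined"
  by (auto simp: Homs_def terminal_cat_def)

lemma terminal_cat_category: "category terminal_cat"
proof
  show "f \<in> Arr terminal_cat \<Longrightarrow> Dom terminal_cat f \<in> Obj terminal_cat" for f
    by (simp add: terminal_cat_def)
  show "f \<in> Arr terminal_cat \<Longrightarrow> Cod terminal_cat f \<in> Obj terminal_cat" for f
    by (simp add: terminal_cat_def)
qed (auto simp: terminal_cat_simps Homs_terminal_cat)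

lemma emb_simps: "Index (emb C c) = terminal_cat" "Ob (emb C c) i = c" "Ar (emb C c) s = Ident C c"
  by (simp_all add: emb_def)

lemma emb_filtered_diagram:
  assumes "category C" "c \<in> Obj C"
  shows "filtered_diagram C (emb C c)"
proof -
  interpret category C by fact
  interpret T: category terminal_cat by (rule terminal_cat_category)
  have "cat_functor terminal_cat C (\<lambda>_. c) (\<lambda>_. Ident C c)"
    using assms(2) Ident_closed[OF assms(2)] Ident_Comp[OF Ident_closed[OF assms(2)]]
    by unfold_locales auto
  moreover have "filtered terminal_cat"
    by (auto simp: filtered_def terminal_cat_category terminal_cat_simps Homs_terminal_cat)
  ultimately show ?thesis
    by (simp add: filtered_diagram_def filtered_diagram_axioms_def emb_def)
qed


text \<open>The index category of \<open>emb C c\<close> has the single object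
  \<open>undefined\<close>, so an arrow out of \<open>emb C c\<close> is a family with one class,
  here that of \<open>(k, f)\<close>.\<close>

definition point ::
  "('o, 'a) cat \<Rightarrow> ('i, 'j, 'o, 'a) diagram \<Rightarrow> 'o \<Rightarrow> 'i \<Rightarrow> 'a \<Rightarrow> ('i, 'j, 'o, 'a) ind_arrow" where
  "point C E c k f = (emb C c, \<lambda>i\<in>{undefined}. colim_class C c E k f, E)"

text \<open>Embedded arrows are themselves points, of a one-object diagram; this makes the results
  on points available for them.\<close>

lemma emb_arr_point:
  "emb_arr C f = point C (emb C (Cod C f)) (Dom C f) undefined f"
  by (auto simp: emb_arr_def point_def colim_class_def intro!: restrict_ext)

lemma (in filtered_diagram) point_eq_iff:
  "point C E c k f = point C E c l g \<longleftrightarrow> colim_class C c E k f = colim_class C c E l g"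
  by (auto simp: point_def fun_eq_iff)

text \<open>The only index arrow of \<open>emb C c\<close> is sent to the identity of
  \<open>c\<close>, and precomposition with it leaves every class unchanged, so compatibility
  imposes nothing further.\<close>

lemma (in filtered_diagram) ind_hom_emb:
  assumes "\<alpha> \<in> extensional {undefined}" "\<alpha> undefined \<in> colim_hom C c E"
  shows "\<alpha> \<in> ind_hom C (emb C c) E"
proof (rule ind_homI)
  show "\<alpha> i = colim_precomp C E (Ar (emb C c) s) (\<alpha> j)" if "s \<in> Homs (Index (emb C c)) i j" for s i j
  proof -
    obtain k f where k: "k \<in> Obj J" and f: "f \<in> Homs C c (Ob E k)" and "\<alpha> undefined = colim_class C c E k f"
      using assms(2) by (rule colim_homE)
    then show ?thesis
      using that colim_precomp_class[OF k f target.Ident_closed[OF target.Homs_Obj(1)[OF f]]]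
        target.Comp_Ident[OF f]
      by (simp add: emb_simps Homs_terminal_cat)
  qed
qed (use assms in \<open>auto simp: emb_simps terminal_cat_simps\<close>)

context filtered_diagram
begin

lemma point_in:
  assumes k: "k \<in> Obj J" and f: "f \<in> Homs C c (Ob E k)"
  shows "point C E c k f \<in> Homs (Ind C) (emb C c) E"
proof -
  have "(\<lambda>i\<in>{undefined}. colim_class C c E k f) \<in> ind_hom C (emb C c) E"
    using colim_class_in[OF k f] by (intro ind_hom_emb) auto
  then show ?thesis
    using emb_filtered_diagram[OF target.category_axioms target.Homs_Obj(1)[OF f]] filtered_diagram_axioms
    by (auto simp: Homs_Ind point_def)
qed

lemma pointE:
  assumes "\<chi> \<in> Homs (Ind C) (emb C c) E"
  obtains k f where "k \<in> Obj J" "f \<in> Homs C c (Ob E k)" "\<chi> = point C E c k f"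
proof -
  obtain \<alpha> where \<alpha>: "\<alpha> \<in> ind_hom C (emb C c) E" and \<chi>: "\<chi> = (emb C c, \<alpha>, E)"
    using assms by (auto simp: Homs_Ind)
  have "\<alpha> undefined \<in> colim_hom C c E"
    using ind_homD(1)[OF \<alpha>, of undefined] by (simp add: emb_simps terminal_cat_simps)
  then obtain k f where kf: "k \<in> Obj J" "f \<in> Homs C c (Ob E k)" "\<alpha> undefined = colim_class C c E k f"
    by (rule colim_homE)
  have "\<alpha> = (\<lambda>i\<in>{undefined}. colim_class C c E k f)"
    using ind_homD(2)[OF \<alpha>] kf(3) by (auto simp: emb_simps terminal_cat_simps extensional_def fun_eq_iff)
  then show thesis
    using that kf \<chi> by (simp add: point_def)
qed

end

lemma emb_arr_in:
  assumes "category C" "f \<in> Homs C c d"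
  shows "(emb_arr C f :: ('i, 'j, 'o, 'a) ind_arrow) \<in> Homs (Ind C) (emb C c) (emb C d)"
proof -
  interpret category C by fact
  interpret d: filtered_diagram C "emb C d :: ('i, 'j, 'o, 'a) diagram"
    using emb_filtered_diagram[OF assms(1) Homs_Obj(2)[OF assms(2)]] .
  show ?thesis
    using d.point_in[of undefined f c] assms(2) HomsD[OF assms(2)]
    by (simp add: emb_arr_point emb_simps terminal_cat_simps)
qed

section \<open>Precomposition of points, colimit legs, and filteredness in terms of points\<close>

context filtered_diagram
begin

abbreviation pull (infixl \<open>\<diamondop>\<close> 70) where "\<chi> \<diamondop> f \<equiv> \<chi> \<odot>\<^bsub>Ind C\<^esub> (emb_arr C f :: ('i, 'j, 'o, 'a) ind_arrow)"

abbreviation points where "points c \<equiv> Homs (Ind C) (emb C c :: ('i, 'j, 'o, 'a) diagram) E"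

text \<open>On representatives, precomposition with an embedded arrow is composition in
  \<open>C\<close>. The families \<open>?\<alpha>\<close> and \<open>?\<beta>\<close> are those
  underlying \<open>emb_arr C h\<close> and the given point.\<close>

lemma point_pull:
  assumes k: "k \<in> Obj J" and f: "f \<in> Homs C c (Ob E k)" and h: "h \<in> Homs C d c"
  shows "point C E c k f \<diamondop> h = point C E d k (f \<odot>\<^bsub>C\<^esub> h)"
proof -
  let ?\<alpha> = "\<lambda>i\<in>{undefined}. colim_class C d (emb C c :: ('i, 'j, 'o, 'a) diagram) undefined h"
  let ?\<beta> = "\<lambda>i\<in>{undefined}. colim_class C c E k f"
  have D: "filtered_diagram C (emb C c :: ('i, 'j, 'o, 'a) diagram)"
    using emb_filtered_diagram[OF target.category_axioms target.Homs_Obj(2)[OF h]] .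
  have \<beta>: "?\<beta> \<in> ind_hom C (emb C c) E"
    using point_in[OF k f] by (auto simp: Homs_Ind point_def)
  have "ind_comp C (emb C d) E ?\<beta> ?\<alpha> undefined = colim_class C (Ob (emb C d) undefined) E k (f \<odot>\<^bsub>C\<^esub> h)"
    using ind_comp_class[where D = "emb C d" and \<alpha> = ?\<alpha> and i = undefined and k = undefined and f = h, OF D filtered_diagram_axioms \<beta>] k f h
    by (simp add: emb_simps terminal_cat_simps)
  then have "ind_comp C (emb C d) E ?\<beta> ?\<alpha> = (\<lambda>i\<in>{undefined}. colim_class C d E k (f \<odot>\<^bsub>C\<^esub> h))"
    by (auto simp: fun_eq_iff emb_simps terminal_cat_simps ind_comp_def)
  then show ?thesis
    using HomsD[OF h] by (simp add: emb_arr_point point_def Ind_simps)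
qed

lemma pull_closed: "\<lbrakk>\<chi> \<in> points c; h \<in> Homs C d c\<rbrakk> \<Longrightarrow> \<chi> \<diamondop> h \<in> points d"
  by (elim pointE) (simp add: point_pull point_in target.Comp_closed)

lemma pull_Comp:
  assumes "\<chi> \<in> points c" "g \<in> Homs C b c" "f \<in> Homs C a b"
  shows "\<chi> \<diamondop> (g \<odot>\<^bsub>C\<^esub> f) = \<chi> \<diamondop> g \<diamondop> f"
proof -
  obtain k p where k: "k \<in> Obj J" and p: "p \<in> Homs C c (Ob E k)" and "\<chi> = point C E c k p"
    using assms(1) by (rule pointE)
  then show ?thesis
    using assms(2,3) point_pull[OF k p] point_pull[OF k target.Comp_closed[OF assms(2) p] assms(3)]
      target.Comp_closed[OF assms(3,2)] target.Comp_assoc[OF assms(3,2) p]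
    by simp
qed

lemma pull_Ident:
  assumes "\<chi> \<in> points c"
  shows "\<chi> \<diamondop> Ident C c = \<chi>"
proof -
  obtain k p where k: "k \<in> Obj J" and p: "p \<in> Homs C c (Ob E k)" and "\<chi> = point C E c k p"
    using assms(1) by (rule pointE)
  then show ?thesis
    using point_pull[OF k p target.Ident_closed[OF target.Homs_Obj(1)[OF p]]] target.Comp_Ident[OF p]
    by simp
qed

text \<open>The legs of the colimit cocone exhibiting \<open>E\<close> as the colimit of its own
  diagram; every point is a leg after an arrow of \<open>C\<close>.\<close>

abbreviation leg where "leg k \<equiv> point C E (Ob E k) k (Ident C (Ob E k))"

lemma leg_in: "k \<in> Obj J \<Longrightarrow> leg k \<in> points (Ob E k)"
  by (intro point_in target.Ident_closed Fo_closed)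

lemma leg_pull: "\<lbrakk>k \<in> Obj J; f \<in> Homs C c (Ob E k)\<rbrakk> \<Longrightarrow> leg k \<diamondop> f = point C E c k f"
  using point_pull[of k "Ident C (Ob E k)" "Ob E k" f c] target.Ident_closed[OF Fo_closed, of k]
    target.Ident_Comp[of f c "Ob E k"] by simp

lemma point_push:
  "\<lbrakk>s \<in> Homs J k l; f \<in> Homs C c (Ob E k)\<rbrakk> \<Longrightarrow> point C E c l (Ar E s \<odot>\<^bsub>C\<^esub> f) = point C E c k f"
  by (simp add: point_eq_iff colim_class_push)

text \<open>The two points are represented at stages \<open>k\<close> and \<open>l\<close>; pushing
  both representatives to a common later stage \<open>m\<close> makes them factor through the leg at
  \<open>m\<close>.\<close>

lemma points_common_factor:
  assumes "\<chi> \<in> points c" "\<xi> \<in> points d"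
  obtains e p f g where "p \<in> points e" "f \<in> Homs C c e" "g \<in> Homs C d e" "\<chi> = p \<diamondop> f" "\<xi> = p \<diamondop> g"
proof -
  obtain k f where k: "k \<in> Obj J" "f \<in> Homs C c (Ob E k)" "\<chi> = point C E c k f"
    using assms(1) by (rule pointE)
  obtain l g where l: "l \<in> Obj J" "g \<in> Homs C d (Ob E l)" "\<xi> = point C E d l g"
    using assms(2) by (rule pointE)
  obtain m s t where s: "s \<in> Homs J k m" and t: "t \<in> Homs J l m"
    using upper_bound[OF k(1) l(1)] by blast
  have m: "m \<in> Obj J" using source.Homs_Obj(2)[OF s] .
  note sf = target.Comp_closed[OF k(2) Fa_closed[OF s]] and tg = target.Comp_closed[OF l(2) Fa_closed[OF t]]
  show thesis
    using k l leg_pull[OF m sf] leg_pull[OF m tg] point_push[OF s k(2)] point_push[OF t l(2)]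
    by (intro that[OF leg_in[OF m] sf tg]) simp_all
qed

text \<open>With \<open>p\<close> represented by \<open>q\<close>, the equation says that
  \<open>q f\<close> and \<open>q g\<close> become equal further along the diagram. The required
  \<open>h\<close> is \<open>q\<close> followed by a transition arrow.\<close>

lemma points_equalize:
  assumes p: "p \<in> points d" and f: "f \<in> Homs C c d" and g: "g \<in> Homs C c d" and eq: "p \<diamondop> f = p \<diamondop> g"
  obtains e h where "h \<in> Homs C d e" "h \<odot>\<^bsub>C\<^esub> f = h \<odot>\<^bsub>C\<^esub> g"
proof -
  obtain k q where k: "k \<in> Obj J" and q: "q \<in> Homs C d (Ob E k)" and pq: "p = point C E d k q"
    using p by (rule pointE)
  note qf = target.Comp_closed[OF f q] and qg = target.Comp_closed[OF g q]
  have "colim_class C c E k (q \<odot>\<^bsub>C\<^esub> f) = colim_class C c E k (q \<odot>\<^bsub>C\<^esub> g)"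
    using eq pq point_pull[OF k q f] point_pull[OF k q g] by (simp add: point_eq_iff)
  then obtain m s t where s: "s \<in> Homs J k m" and t: "t \<in> Homs J k m"
    and st: "Ar E s \<odot>\<^bsub>C\<^esub> (q \<odot>\<^bsub>C\<^esub> f) = Ar E t \<odot>\<^bsub>C\<^esub> (q \<odot>\<^bsub>C\<^esub> g)"
    using colim_class_eq_iff[OF k qf k qg] by blast
  \<comment> \<open>Equality of classes only provides two parallel transitions \<open>s\<close> and
    \<open>t\<close>, possibly different; a single \<open>h\<close> requires merging them.\<close>
  obtain n r where r: "r \<in> Homs J m n" and rst: "r \<odot>\<^bsub>J\<^esub> s = r \<odot>\<^bsub>J\<^esub> t"
    using coequalize[OF s t] by blast
  note A = Fa_closed[OF source.Comp_closed[OF s r]]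
  have "Ar E (r \<odot>\<^bsub>J\<^esub> s) \<odot>\<^bsub>C\<^esub> (q \<odot>\<^bsub>C\<^esub> f) = Ar E (r \<odot>\<^bsub>J\<^esub> s) \<odot>\<^bsub>C\<^esub> (q \<odot>\<^bsub>C\<^esub> g)"
    using Ar_Comp_assoc[OF qf s r] Ar_Comp_assoc[OF qg t r] st rst by simp
  then show thesis
    using target.Comp_assoc[OF f q A] target.Comp_assoc[OF g q A] by (intro that[OF target.Comp_closed[OF q A]]) simp
qed

end


lemma strict_monomorphismD:
  assumes "strict_monomorphism C f" "f \<in> Homs C d c" "e \<in> Obj C" "g \<in> Homs C e c"
    and "\<And>b h k. \<lbrakk>b \<in> Obj C; h \<in> Homs C c b; k \<in> Homs C c b; h \<odot>\<^bsub>C\<^esub> f = k \<odot>\<^bsub>C\<^esub> f\<rbrakk> \<Longrightarrow>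
      h \<odot>\<^bsub>C\<^esub> g = k \<odot>\<^bsub>C\<^esub> g"
  shows "\<exists>!x. x \<in> Homs C e d \<and> f \<odot>\<^bsub>C\<^esub> x = g"
  using assms(1) assms(3-5) unfolding strict_monomorphism_def HomsD(2,3)[OF assms(2)] by blast

lemma strict_monomorphismI:
  assumes "f \<in> Homs C d c"
    and "\<And>e g. \<lbrakk>e \<in> Obj C; g \<in> Homs C e c;
        \<And>b h k. \<lbrakk>b \<in> Obj C; h \<in> Homs C c b; k \<in> Homs C c b; h \<odot>\<^bsub>C\<^esub> f = k \<odot>\<^bsub>C\<^esub> f\<rbrakk> \<Longrightarrow>
          h \<odot>\<^bsub>C\<^esub> g = k \<odot>\<^bsub>C\<^esub> g\<rbrakk> \<Longrightarrow>
      \<exists>!x. x \<in> Homs C e d \<and> f \<odot>\<^bsub>C\<^esub> x = g"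
  shows "strict_monomorphism C f"
  using HomsD(1)[OF assms(1)] assms(2) unfolding strict_monomorphism_def HomsD(2,3)[OF assms(1)] by blast


section \<open>Universal and ultrahomogeneous ind-objects\<close>

locale homogeneous_object = filtered_diagram C u
  for C :: "('o, 'a) cat" and u :: "('i, 'j, 'o, 'a) diagram" +
  assumes universal: "universal_object C u"
    and homogeneous: "ultrahomogeneous C u"
begin

interpretation Ind: bare_category "Ind C :: (('i, 'j, 'o, 'a) diagram, _) cat"
  by (rule Ind_category)

abbreviation auts where "auts \<equiv> Isos (Ind C) u u"

text \<open>One composition serves as the action on points and as the multiplication of
  automorphisms. Since \<open>\<star>\<close> and \<open>\<diamondop>\<close> associate to the left
  at the same priority, \<open>g \<star> \<chi> \<diamondop> f\<close> is the moved point
  \<open>g \<star> \<chi>\<close> pulled back along \<open>f\<close>.\<close>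

abbreviation act (infixl \<open>\<star>\<close> 70) where "g \<star> \<chi> \<equiv> g \<odot>\<^bsub>Ind C\<^esub> (\<chi> :: ('i, 'j, 'o, 'a) ind_arrow)"

definition monic_points :: bool where
  "monic_points \<longleftrightarrow> (\<forall>c\<in>Obj C. \<forall>d\<in>Obj C. \<forall>f\<in>Homs C c d. \<forall>g\<in>Homs C c d. \<forall>\<xi>\<in>points d.
     \<xi> \<diamondop> f = \<xi> \<diamondop> g \<longrightarrow> f = g)"

definition fixing_factors :: bool where
  "fixing_factors \<longleftrightarrow> (\<forall>c\<in>Obj C. \<forall>d\<in>Obj C. \<forall>\<chi>\<in>points c. \<forall>\<xi>\<in>points d.
     fixing C u \<xi> \<subseteq> fixing C u \<chi> \<longrightarrow> (\<exists>f\<in>Homs C c d. \<chi> = \<xi> \<diamondop> f))"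

lemma monic_pointsD:
  "\<lbrakk>monic_points; \<xi> \<in> points d; f \<in> Homs C c d; g \<in> Homs C c d; \<xi> \<diamondop> f = \<xi> \<diamondop> g\<rbrakk> \<Longrightarrow> f = g"
  using target.Homs_Obj unfolding monic_points_def by meson

lemma fixing_factorsE:
  assumes "fixing_factors" "\<chi> \<in> points c" "\<xi> \<in> points d" "c \<in> Obj C" "d \<in> Obj C"
    and "fixing C u \<xi> \<subseteq> fixing C u \<chi>"
  obtains f where "f \<in> Homs C c d" "\<chi> = \<xi> \<diamondop> f"
  using assms unfolding fixing_factors_def by meson

section \<open>The automorphism group acting on points\<close>

lemma point_exists:
  assumes "c \<in> Obj C"
  obtains \<chi> where "\<chi> \<in> points c"
  using assms universal unfolding universal_object_def by blast

lemma u_in: "u \<in> Obj (Ind C)"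
  using filtered_diagram_axioms by (simp add: Obj_Ind)

lemma act_closed: "\<lbrakk>g \<in> auts; \<chi> \<in> points c\<rbrakk> \<Longrightarrow> g \<star> \<chi> \<in> points c"
  by (rule Ind.Comp_closed[OF _ Ind.Isos_Homs])

lemma act_pull: "\<lbrakk>g \<in> auts; \<chi> \<in> points c; f \<in> Homs C d c\<rbrakk> \<Longrightarrow> g \<star> (\<chi> \<diamondop> f) = g \<star> \<chi> \<diamondop> f"
  using Ind.Comp_assoc[OF emb_arr_in[OF target.category_axioms] _ Ind.Isos_Homs] by simp

lemma act_Comp: "\<lbrakk>g \<in> auts; h \<in> auts; \<chi> \<in> points c\<rbrakk> \<Longrightarrow> g \<star> h \<star> \<chi> = g \<star> (h \<star> \<chi>)"
  by (rule Ind.Comp_assoc[OF _ Ind.Isos_Homs Ind.Isos_Homs])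

lemma act_Ident: "\<chi> \<in> points c \<Longrightarrow> Ident (Ind C) u \<star> \<chi> = \<chi>"
  by (rule Ind.Ident_Comp)

lemma auts_inverse:
  assumes "g \<in> auts"
  obtains g' where "g' \<in> auts" "g' \<star> g = Ident (Ind C) u" "g \<star> g' = Ident (Ind C) u"
  using assms unfolding Isos_def by blast

text \<open>The inverse of \<open>h\<close> followed after \<open>g\<close> fixes
  \<open>\<xi>\<close>, hence fixes \<open>\<chi>\<close>. In this form the inclusion of stabilizers
  applies to pairs of automorphisms.\<close>

lemma fixing_subset_act_eq:
  assumes sub: "fixing C u \<xi> \<subseteq> fixing C u \<chi>" and \<xi>: "\<xi> \<in> points d" and \<chi>: "\<chi> \<in> points c"
    and g: "g \<in> auts" and h: "h \<in> auts" and eq: "g \<star> \<xi> = h \<star> \<xi>"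
  shows "g \<star> \<chi> = h \<star> \<chi>"
proof -
  obtain h' where h': "h' \<in> auts" "h' \<star> h = Ident (Ind C) u" "h \<star> h' = Ident (Ind C) u"
    using auts_inverse[OF h] .
  have "h' \<star> g \<star> \<xi> = \<xi>"
    using act_Comp[OF h'(1) g \<xi>] act_Comp[OF h'(1) h \<xi>] act_Ident[OF \<xi>] h'(2) eq by simp
  then have "h' \<star> g \<star> \<chi> = \<chi>"
    using sub Ind.Isos_Comp[OF g h'(1)] by (auto simp: fixing_def)
  then have "h \<star> (h' \<star> (g \<star> \<chi>)) = h \<star> \<chi>"
    using act_Comp[OF h'(1) g \<chi>] by simp
  then show ?thesis
    using act_Comp[OF h h'(1) act_closed[OF g \<chi>]] act_Ident[OF act_closed[OF g \<chi>]] h'(3) by simp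
qed

lemma homogeneous_transfer:
  assumes "j \<in> Homs C a b" "\<chi> \<in> points a" "\<psi> \<in> points b"
  obtains g where "g \<in> auts" "g \<star> \<chi> = \<psi> \<diamondop> j"
  using assms target.Homs_Obj[OF assms(1)] homogeneous unfolding ultrahomogeneous_def by meson

text \<open>Ultrahomogeneity for the identity arrow of \<open>c\<close>.\<close>

lemma auts_transitive:
  assumes "c \<in> Obj C" "\<chi> \<in> points c" "\<psi> \<in> points c"
  obtains g where "g \<in> auts" "g \<star> \<chi> = \<psi>"
  using homogeneous_transfer[OF target.Ident_closed[OF assms(1)] assms(2,3)] pull_Ident[OF assms(3)]
  by metis

section \<open>Strict monomorphisms and stabilizers of points\<close>

lemma fixing_pull:
  assumes "\<xi> \<in> points d" "f \<in> Homs C c d"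
  shows "fixing C u \<xi> \<subseteq> fixing C u (\<xi> \<diamondop> f)"
  using assms act_pull[OF _ assms] by (auto simp: fixing_def)

text \<open>Strictness is applied to the arrow \<open>h f\<close>, on which any two arrows agreeing
  on \<open>h\<close> agree trivially. Both \<open>f\<close> and \<open>g\<close> factor it through
  \<open>h\<close>, so uniqueness identifies them.\<close>

lemma strict_monomorphism_cancel:
  assumes "strict_monomorphism C h" "h \<in> Homs C d e" "f \<in> Homs C c d" "g \<in> Homs C c d"
    and "h \<odot>\<^bsub>C\<^esub> f = h \<odot>\<^bsub>C\<^esub> g"
  shows "f = g"
proof -
  have "p \<odot>\<^bsub>C\<^esub> (h \<odot>\<^bsub>C\<^esub> f) = q \<odot>\<^bsub>C\<^esub> (h \<odot>\<^bsub>C\<^esub> f)"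
    if "p \<in> Homs C e b" "q \<in> Homs C e b" "p \<odot>\<^bsub>C\<^esub> h = q \<odot>\<^bsub>C\<^esub> h" for b p q
    using that target.Comp_assoc[OF assms(3,2) that(1)] target.Comp_assoc[OF assms(3,2) that(2)] by simp
  then have "\<exists>!x. x \<in> Homs C c d \<and> h \<odot>\<^bsub>C\<^esub> x = h \<odot>\<^bsub>C\<^esub> f"
    by (intro strict_monomorphismD[OF assms(1,2) target.Homs_Obj(1)[OF assms(3)] target.Comp_closed[OF assms(3,2)]])
  then show ?thesis
    using assms(3-5) by auto
qed

text \<open>Two arrows identified by a point are identified by an arrow \<open>h\<close> of
  \<open>C\<close>, and strictness of \<open>h\<close> allows it to be cancelled.\<close>

lemma strict_monomorphisms_imp_monic_points:
  assumes "\<forall>f\<in>Arr C. strict_monomorphism C f"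
  shows monic_points
  unfolding monic_points_def
proof (intro ballI impI)
  fix c d f g \<xi>
  assume f: "f \<in> Homs C c d" and g: "g \<in> Homs C c d" and "\<xi> \<in> points d" "\<xi> \<diamondop> f = \<xi> \<diamondop> g"
  then obtain e h where h: "h \<in> Homs C d e" "h \<odot>\<^bsub>C\<^esub> f = h \<odot>\<^bsub>C\<^esub> g"
    using points_equalize[of \<xi> d f c g] by blast
  then have "strict_monomorphism C h"
    using assms HomsD(1)[OF h(1)] by blast
  then show "f = g"
    using h(1) f g h(2) by (rule strict_monomorphism_cancel)
qed

text \<open>
  Write \<open>\<xi> = p \<diamondop> f\<close> and \<open>\<chi> = p \<diamondop> g\<close> over a common object \<open>e\<close>. Ultrahomogeneity turns arrows
  \<open>h\<close>, \<open>k\<close> out of \<open>e\<close> with \<open>h f = k f\<close> into automorphisms \<open>s\<close>, \<open>t\<close> of \<open>u\<close> that agree on \<open>\<xi>\<close>,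
  hence on \<open>\<chi>\<close>; so \<open>h g = k g\<close>, and strictness of \<open>f\<close> yields the factorization.
\<close>

lemma strict_monomorphisms_imp_fixing_factors:
  assumes strict: "\<forall>f\<in>Arr C. strict_monomorphism C f"
  shows fixing_factors
  unfolding fixing_factors_def
proof (intro ballI impI)
  fix c d \<chi> \<xi>
  assume c: "c \<in> Obj C" and \<chi>: "\<chi> \<in> points c" and \<xi>: "\<xi> \<in> points d"
    and sub: "fixing C u \<xi> \<subseteq> fixing C u \<chi>"
  note monic = monic_pointsD[OF strict_monomorphisms_imp_monic_points[OF strict]]
  obtain e p g f where p: "p \<in> points e" and g: "g \<in> Homs C c e" and f: "f \<in> Homs C d e"
    and pg: "\<chi> = p \<diamondop> g" and pf: "\<xi> = p \<diamondop> f"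
    using points_common_factor[OF \<chi> \<xi>] .
  have "h \<odot>\<^bsub>C\<^esub> g = k \<odot>\<^bsub>C\<^esub> g"
    if b: "b \<in> Obj C" and h: "h \<in> Homs C e b" and k: "k \<in> Homs C e b" and hk: "h \<odot>\<^bsub>C\<^esub> f = k \<odot>\<^bsub>C\<^esub> f" for b h k
  proof -
    obtain q where q: "q \<in> points b" using point_exists[OF b] .
    obtain s where s: "s \<in> auts" "s \<star> p = q \<diamondop> h" using homogeneous_transfer[OF h p q] .
    obtain t where t: "t \<in> auts" "t \<star> p = q \<diamondop> k" using homogeneous_transfer[OF k p q] .
    have push: "s \<star> (p \<diamondop> x) = q \<diamondop> (h \<odot>\<^bsub>C\<^esub> x)" "t \<star> (p \<diamondop> x) = q \<diamondop> (k \<odot>\<^bsub>C\<^esub> x)" if x: "x \<in> Homs C a e" for a x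
      using act_pull[OF s(1) p x] act_pull[OF t(1) p x] s(2) t(2) pull_Comp[OF q h x] pull_Comp[OF q k x]
      by simp_all
    have "s \<star> \<xi> = t \<star> \<xi>"
      using push[OF f] hk pf by simp
    then have "s \<star> \<chi> = t \<star> \<chi>"
      by (rule fixing_subset_act_eq[OF sub \<xi> \<chi> s(1) t(1)])
    then have "q \<diamondop> (h \<odot>\<^bsub>C\<^esub> g) = q \<diamondop> (k \<odot>\<^bsub>C\<^esub> g)"
      using push[OF g] pg by simp
    \<comment> \<open>Monicity of points, already a consequence of strictness, removes
      \<open>q\<close>.\<close>
    then show ?thesis
      using monic[OF q target.Comp_closed[OF g h] target.Comp_closed[OF g k]] by simp
  qed
  moreover have "strict_monomorphism C f"
    using strict HomsD(1)[OF f] by blast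
  ultimately have "\<exists>!x. x \<in> Homs C c d \<and> f \<odot>\<^bsub>C\<^esub> x = g"
    by (intro strict_monomorphismD[OF _ f c g])
  then obtain x where x: "x \<in> Homs C c d" "f \<odot>\<^bsub>C\<^esub> x = g"
    by blast
  then have "\<chi> = \<xi> \<diamondop> x"
    using pull_Comp[OF p f x(1)] pf pg by simp
  then show "\<exists>x\<in>Homs C c d. \<chi> = \<xi> \<diamondop> x"
    using x(1) by blast
qed

text \<open>Relative to a point \<open>\<zeta>\<close> at \<open>c\<close>, the condition on
  \<open>g\<close> says that every automorphism fixing \<open>\<zeta> f\<close> also fixes
  \<open>\<zeta> g\<close>. Hence \<open>\<zeta> g\<close> factors through \<open>\<zeta> f\<close>,
  and monicity of \<open>\<zeta>\<close> turns this into a factorization of \<open>g\<close> through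
  \<open>f\<close>.\<close>

lemma monic_fixing_imp_strict_monomorphism:
  assumes P: monic_points and Q: fixing_factors and f: "f \<in> Homs C d c"
  shows "strict_monomorphism C f"
proof (rule strict_monomorphismI[OF f])
  obtain \<zeta> where \<zeta>: "\<zeta> \<in> points c" using point_exists[OF target.Homs_Obj(2)[OF f]] .
  show "\<exists>!x. x \<in> Homs C e d \<and> f \<odot>\<^bsub>C\<^esub> x = g"
    if g: "g \<in> Homs C e c"
      and eq: "\<And>b h k. \<lbrakk>b \<in> Obj C; h \<in> Homs C c b; k \<in> Homs C c b; h \<odot>\<^bsub>C\<^esub> f = k \<odot>\<^bsub>C\<^esub> f\<rbrakk> \<Longrightarrow> h \<odot>\<^bsub>C\<^esub> g = k \<odot>\<^bsub>C\<^esub> g"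
    for e g
  proof -
    have "fixing C u (\<zeta> \<diamondop> f) \<subseteq> fixing C u (\<zeta> \<diamondop> g)"
    proof
      fix s assume "s \<in> fixing C u (\<zeta> \<diamondop> f)"
      then have s: "s \<in> auts" and "s \<star> (\<zeta> \<diamondop> f) = \<zeta> \<diamondop> f"
        by (simp_all add: fixing_def)
      then have sf: "s \<star> \<zeta> \<diamondop> f = \<zeta> \<diamondop> f"
        using act_pull[OF s \<zeta> f] by simp
      \<comment> \<open>The automorphism \<open>s\<close> is converted into the pair
        \<open>h\<close>, \<open>k\<close> to which the condition on \<open>g\<close>
        applies.\<close>
      obtain b p h k where p: "p \<in> points b" and h: "h \<in> Homs C c b" and k: "k \<in> Homs C c b"
        and ph: "s \<star> \<zeta> = p \<diamondop> h" and pk: "\<zeta> = p \<diamondop> k"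
        using points_common_factor[OF act_closed[OF s \<zeta>] \<zeta>] .
      have "p \<diamondop> (h \<odot>\<^bsub>C\<^esub> f) = p \<diamondop> (k \<odot>\<^bsub>C\<^esub> f)"
        using pull_Comp[OF p h f] pull_Comp[OF p k f] sf ph pk by simp
      then have "h \<odot>\<^bsub>C\<^esub> f = k \<odot>\<^bsub>C\<^esub> f"
        using monic_pointsD[OF P p target.Comp_closed[OF f h] target.Comp_closed[OF f k]] by simp
      then have "h \<odot>\<^bsub>C\<^esub> g = k \<odot>\<^bsub>C\<^esub> g"
        by (rule eq[OF target.Homs_Obj(2)[OF h] h k])
      then have "s \<star> (\<zeta> \<diamondop> g) = \<zeta> \<diamondop> g"
        using act_pull[OF s \<zeta> g] pull_Comp[OF p h g] pull_Comp[OF p k g] ph pk by simp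
      then show "s \<in> fixing C u (\<zeta> \<diamondop> g)"
        using s by (simp add: fixing_def)
    qed
    then obtain x where x: "x \<in> Homs C e d" and "\<zeta> \<diamondop> g = \<zeta> \<diamondop> f \<diamondop> x"
      by (rule fixing_factorsE[OF Q pull_closed[OF \<zeta> g] pull_closed[OF \<zeta> f]
            target.Homs_Obj(1)[OF g] target.Homs_Obj(1)[OF f]])
    then have fx: "f \<odot>\<^bsub>C\<^esub> x = g"
      using monic_pointsD[OF P \<zeta> target.Comp_closed[OF x f] g] pull_Comp[OF \<zeta> f x] by simp
    \<comment> \<open>Uniqueness comes from the point \<open>\<zeta> f\<close> at \<open>d\<close>,
      which is monic as well.\<close>
    moreover have "y = x" if y: "y \<in> Homs C e d" and "f \<odot>\<^bsub>C\<^esub> y = g" for y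
    proof -
      have "\<zeta> \<diamondop> f \<diamondop> y = \<zeta> \<diamondop> f \<diamondop> x"
        using pull_Comp[OF \<zeta> f x] pull_Comp[OF \<zeta> f y] that(2) fx by simp
      then show ?thesis
        using monic_pointsD[OF P pull_closed[OF \<zeta> f] y x] by simp
    qed
    ultimately show ?thesis
      using x by blast
  qed
qed

lemma strict_monomorphisms_iff:
  "(\<forall>f\<in>Arr C. strict_monomorphism C f) \<longleftrightarrow> monic_points \<and> fixing_factors"
  using strict_monomorphisms_imp_monic_points strict_monomorphisms_imp_fixing_factors
    monic_fixing_imp_strict_monomorphism[OF _ _ Homs_Dom_Cod] by blast

text \<open>A point pulled back from \<open>\<xi>\<close> always has the larger stabilizer. So the
  right-hand side implies the inclusion without further conditions, and uniqueness can be invoked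
  for \<open>\<chi> = \<xi> f\<close> with any \<open>f\<close>, which is monicity of
  \<open>\<xi>\<close>.\<close>

lemma unique_factor_iff:
  "(\<forall>c\<in>Obj C. \<forall>d\<in>Obj C. \<forall>\<chi>\<in>points c. \<forall>\<xi>\<in>points d.
      fixing C u \<xi> \<subseteq> fixing C u \<chi> \<longleftrightarrow> (\<exists>!f. f \<in> Homs C c d \<and> \<chi> = \<xi> \<diamondop> f)) \<longleftrightarrow>
    monic_points \<and> fixing_factors"
    (is "?L \<longleftrightarrow> _")
proof
  assume L: ?L
  have monic_points
    unfolding monic_points_def
  proof (intro ballI impI)
    fix c d f g \<xi>
    assume c: "c \<in> Obj C" and d: "d \<in> Obj C" and f: "f \<in> Homs C c d" and g: "g \<in> Homs C c d"
      and \<xi>: "\<xi> \<in> points d" and eq: "\<xi> \<diamondop> f = \<xi> \<diamondop> g"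
    have "\<exists>!h. h \<in> Homs C c d \<and> \<xi> \<diamondop> f = \<xi> \<diamondop> h"
      using L c d \<xi> pull_closed[OF \<xi> f] fixing_pull[OF \<xi> f] by blast
    then show "f = g"
      using f g eq by blast
  qed
  moreover have fixing_factors
    unfolding fixing_factors_def
  proof (intro ballI impI)
    fix c d \<chi> \<xi>
    assume "c \<in> Obj C" "d \<in> Obj C" "\<chi> \<in> points c" "\<xi> \<in> points d" "fixing C u \<xi> \<subseteq> fixing C u \<chi>"
    with L have "\<exists>!f. f \<in> Homs C c d \<and> \<chi> = \<xi> \<diamondop> f" by blast
    then show "\<exists>f\<in>Homs C c d. \<chi> = \<xi> \<diamondop> f" by blast
  qed
  ultimately show "monic_points \<and> fixing_factors" ..
next
  assume "monic_points \<and> fixing_factors"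
  then have P: monic_points and Q: fixing_factors by auto
  show ?L
  proof (intro ballI iffI)
    fix c d \<chi> \<xi>
    assume obj: "c \<in> Obj C" "d \<in> Obj C" and \<chi>: "\<chi> \<in> points c" and \<xi>: "\<xi> \<in> points d"
    show "\<exists>!f. f \<in> Homs C c d \<and> \<chi> = \<xi> \<diamondop> f" if sub: "fixing C u \<xi> \<subseteq> fixing C u \<chi>"
    proof -
      obtain f where f: "f \<in> Homs C c d" "\<chi> = \<xi> \<diamondop> f"
        using fixing_factorsE[OF Q \<chi> \<xi> obj sub] .
      then show ?thesis
        using monic_pointsD[OF P \<xi> _ f(1)] by (intro ex1I[of _ f]) auto
    qed
    show "fixing C u \<xi> \<subseteq> fixing C u \<chi>" if "\<exists>!f. f \<in> Homs C c d \<and> \<chi> = \<xi> \<diamondop> f"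
      using that fixing_pull[OF \<xi>] by blast
  qed
qed

section \<open>The topology on the automorphism group\<close>

abbreviation G where "G \<equiv> Aut (Ind C) u"

lemma Aut_simps: "carrier G = auts" "g \<otimes>\<^bsub>G\<^esub> h = g \<star> h" "\<one>\<^bsub>G\<^esub> = Ident (Ind C) u"
  by (simp_all add: Aut_def)

lemma fixing_subgroupsI: "\<chi> \<in> points c \<Longrightarrow> c \<in> Obj C \<Longrightarrow> fixing C u \<chi> \<in> fixing_subgroups C u"
  unfolding fixing_subgroups_def by blast

text \<open>A point through which both given points factor has a stabilizer inside both stabilizers.
  This is what makes intersections of open sets open.\<close>

lemma fixing_subgroups_directed:
  assumes "H \<in> fixing_subgroups C u" "K \<in> fixing_subgroups C u"
  obtains L where "L \<in> fixing_subgroups C u" "L \<subseteq> H" "L \<subseteq> K"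
proof -
  obtain c \<chi> d \<xi> where \<chi>: "\<chi> \<in> points c" "H = fixing C u \<chi>" and \<xi>: "\<xi> \<in> points d" "K = fixing C u \<xi>"
    using assms by (auto simp: fixing_subgroups_def)
  obtain e p f g where p: "p \<in> points e" "f \<in> Homs C c e" "g \<in> Homs C d e" "\<chi> = p \<diamondop> f" "\<xi> = p \<diamondop> g"
    using points_common_factor[OF \<chi>(1) \<xi>(1)] .
  then show thesis
    using fixing_pull[OF p(1,2)] fixing_pull[OF p(1,3)] \<chi>(2) \<xi>(2)
    by (intro that[OF fixing_subgroupsI[OF p(1) target.Homs_Obj(2)[OF p(2)]]]) simp_all
qed

text \<open>The predicate passed to \<open>topology\<close> has to be shown to define a topology
  before openness unfolds to it; binary intersections are the case that uses directedness of the
  stabilizers.\<close>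

lemma openin_Aut_topology:
  "openin (Aut_topology C u) U \<longleftrightarrow>
     U \<subseteq> auts \<and> (\<forall>g\<in>U. \<exists>H\<in>fixing_subgroups C u. g <#\<^bsub>G\<^esub> H \<subseteq> U)"
proof -
  have "istopology (\<lambda>U. U \<subseteq> carrier G \<and> (\<forall>g\<in>U. \<exists>H\<in>fixing_subgroups C u. g <#\<^bsub>G\<^esub> H \<subseteq> U))"
    unfolding istopology_def
  proof (intro conjI allI impI ballI)
    fix S T g
    assume S: "S \<subseteq> carrier G \<and> (\<forall>g\<in>S. \<exists>H\<in>fixing_subgroups C u. g <#\<^bsub>G\<^esub> H \<subseteq> S)"
      and T: "T \<subseteq> carrier G \<and> (\<forall>g\<in>T. \<exists>H\<in>fixing_subgroups C u. g <#\<^bsub>G\<^esub> H \<subseteq> T)"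
      and g: "g \<in> S \<inter> T"
    obtain H where H: "H \<in> fixing_subgroups C u" "g <#\<^bsub>G\<^esub> H \<subseteq> S" using S g by blast
    obtain K where K: "K \<in> fixing_subgroups C u" "g <#\<^bsub>G\<^esub> K \<subseteq> T" using T g by blast
    obtain L where L: "L \<in> fixing_subgroups C u" "L \<subseteq> H" "L \<subseteq> K"
      using fixing_subgroups_directed[OF H(1) K(1)] .
    have "g <#\<^bsub>G\<^esub> L \<subseteq> g <#\<^bsub>G\<^esub> H" "g <#\<^bsub>G\<^esub> L \<subseteq> g <#\<^bsub>G\<^esub> K"
      unfolding l_coset_def by (intro UN_mono L order_refl)+
    then show "\<exists>L\<in>fixing_subgroups C u. g <#\<^bsub>G\<^esub> L \<subseteq> S \<inter> T"
      using H(2) K(2) L(1) by blast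
  next
    fix \<K> g
    assume \<K>: "\<forall>K\<in>\<K>. K \<subseteq> carrier G \<and> (\<forall>g\<in>K. \<exists>H\<in>fixing_subgroups C u. g <#\<^bsub>G\<^esub> H \<subseteq> K)"
      and "g \<in> \<Union>\<K>"
    then obtain K H where "K \<in> \<K>" "H \<in> fixing_subgroups C u" "g <#\<^bsub>G\<^esub> H \<subseteq> K"
      by blast
    then show "\<exists>H\<in>fixing_subgroups C u. g <#\<^bsub>G\<^esub> H \<subseteq> \<Union>\<K>"
      by (intro bexI[of _ H]) auto
  qed auto
  then show ?thesis
    by (simp add: Aut_topology_def Aut_simps(1))
qed

text \<open>The left cosets of a stabilizer are the fibres of the orbit map
  \<open>g \<mapsto> g \<chi>\<close>. Questions about cosets thereby become equations between
  points.\<close>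

lemma l_coset_fixing:
  assumes g: "g \<in> auts" and \<chi>: "\<chi> \<in> points c"
  shows "g <#\<^bsub>G\<^esub> fixing C u \<chi> = {h \<in> auts. h \<star> \<chi> = g \<star> \<chi>}"
proof (intro equalityI subsetI)
  fix h assume "h \<in> g <#\<^bsub>G\<^esub> fixing C u \<chi>"
  then obtain k where "k \<in> auts" "k \<star> \<chi> = \<chi>" "h = g \<star> k"
    by (auto simp: l_coset_def fixing_def Aut_simps)
  then show "h \<in> {h \<in> auts. h \<star> \<chi> = g \<star> \<chi>}"
    using Ind.Isos_Comp[OF _ g] act_Comp[OF g _ \<chi>] by simp
next
  fix h assume "h \<in> {h \<in> auts. h \<star> \<chi> = g \<star> \<chi>}"
  then have h: "h \<in> auts" and eq: "h \<star> \<chi> = g \<star> \<chi>" by auto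
  obtain g' where g': "g' \<in> auts" "g' \<star> g = Ident (Ind C) u" "g \<star> g' = Ident (Ind C) u"
    using auts_inverse[OF g] .
  have "g' \<star> h \<star> \<chi> = \<chi>"
    using act_Comp[OF g'(1) h \<chi>] act_Comp[OF g'(1) g \<chi>] act_Ident[OF \<chi>] g'(2) eq by simp
  then have "g' \<star> h \<in> fixing C u \<chi>"
    using Ind.Isos_Comp[OF h g'(1)] by (simp add: fixing_def)
  moreover have "g \<star> (g' \<star> h) = h"
    using Ind.Comp_assoc[OF Ind.Isos_Homs[OF h] Ind.Isos_Homs[OF g'(1)] Ind.Isos_Homs[OF g]]
      Ind.Ident_Comp[OF Ind.Isos_Homs[OF h]] g'(3) by simp
  ultimately show "h \<in> g <#\<^bsub>G\<^esub> fixing C u \<chi>"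
    by (force simp: l_coset_def Aut_simps)
qed

lemma openin_transporter:
  assumes "\<chi> \<in> points c" "c \<in> Obj C"
  shows "openin (Aut_topology C u) {h \<in> auts. h \<star> \<chi> = \<psi>}"
  unfolding openin_Aut_topology
proof (intro conjI ballI)
  fix g assume "g \<in> {h \<in> auts. h \<star> \<chi> = \<psi>}"
  then show "\<exists>H\<in>fixing_subgroups C u. g <#\<^bsub>G\<^esub> H \<subseteq> {h \<in> auts. h \<star> \<chi> = \<psi>}"
    using l_coset_fixing[OF _ assms(1)] by (intro bexI[OF _ fixing_subgroupsI[OF assms]]) auto
qed auto

lemma topspace_Aut_topology: "topspace (Aut_topology C u) = auts"
proof
  show "topspace (Aut_topology C u) \<subseteq> auts"
    using openin_topspace openin_Aut_topology by blast
  show "auts \<subseteq> topspace (Aut_topology C u)"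
  proof
    fix g assume g: "g \<in> auts"
    \<comment> \<open>Some point has to exist for \<open>g\<close> to have a basic neighbourhood;
      the index category is nonempty, so a leg provides one.\<close>
    obtain k where "k \<in> Obj J"
      using filtered_Index unfolding filtered_def by blast
    then have "openin (Aut_topology C u) {h \<in> auts. h \<star> leg k = g \<star> leg k}"
      using openin_transporter leg_in Fo_closed by blast
    then show "g \<in> topspace (Aut_topology C u)"
      using g openin_subset by fastforce
  qed
qed

section \<open>Sets of points as continuous transitive actions\<close>

lemma fst_hom_action: "fst (hom_action C u c) = points c"
  by (simp add: hom_action_def)

lemma snd_hom_action: "\<chi> \<in> points c \<Longrightarrow> snd (hom_action C u c) g \<chi> = g \<star> \<chi>"
  by (simp add: hom_action_def)

lemma hom_action_group_action: "group_action G (points c) (snd (hom_action C u c))"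
proof -
  have Bij: "snd (hom_action C u c) g \<in> Bij (points c)" if g: "g \<in> auts" for g
  proof -
    obtain g' where g': "g' \<in> auts" "g' \<star> g = Ident (Ind C) u" "g \<star> g' = Ident (Ind C) u"
      using auts_inverse[OF g] .
    have "bij_betw (snd (hom_action C u c) g) (points c) (points c)"
    proof (rule bij_betw_byWitness[where f' = "\<lambda>\<chi>. g' \<star> \<chi>"])
      show "\<forall>\<chi>\<in>points c. g' \<star> snd (hom_action C u c) g \<chi> = \<chi>"
        using g'(2) act_Comp[OF g'(1) g] act_Ident by (simp add: snd_hom_action)
      show "\<forall>\<chi>\<in>points c. snd (hom_action C u c) g (g' \<star> \<chi>) = \<chi>"
        using g'(3) act_Comp[OF g g'(1)] act_Ident act_closed[OF g'(1)] by (simp add: snd_hom_action)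
    qed (use act_closed[OF g] act_closed[OF g'(1)] in \<open>auto simp: snd_hom_action\<close>)
    \<comment> \<open>Members of \<open>Bij\<close> are extensional, which the restriction in
      \<open>hom_action\<close> guarantees.\<close>
    then show ?thesis
      by (simp add: Bij_def hom_action_def)
  qed
  have "snd (hom_action C u c) (g \<star> h) = compose (points c) (snd (hom_action C u c) g) (snd (hom_action C u c) h)"
    if "g \<in> auts" "h \<in> auts" for g h
    using act_Comp[OF that] act_closed[OF that(2)] by (auto simp: hom_action_def compose_def intro!: restrict_ext)
  then have "snd (hom_action C u c) \<in> hom G (BijGroup (points c))"
    using Bij by (auto simp: hom_def BijGroup_def Aut_simps)
  then show ?thesis
    using Ind.Aut_group[OF u_in] group_BijGroup
    by (simp add: group_action_def group_hom_def group_hom_axioms_def)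
qed

text \<open>The set of points is discrete, so continuity at \<open>(g, \<chi>)\<close> asks for a
  neighbourhood of \<open>g\<close> on which the image of \<open>\<chi>\<close> is constant; the
  coset of the stabilizer of \<open>\<chi>\<close> through \<open>g\<close> is one.\<close>

lemma hom_action_continuous:
  assumes c: "c \<in> Obj C"
  shows "continuous_action G (Aut_topology C u) (hom_action C u c)"
proof -
  let ?a = "\<lambda>(g, \<chi>). snd (hom_action C u c) g \<chi>"
  let ?T = "prod_topology (Aut_topology C u) (discrete_topology (points c))"
  have "continuous_map ?T (discrete_topology (points c)) ?a"
    unfolding continuous_map_def
  proof (intro conjI allI impI)
    show "?a \<in> topspace ?T \<rightarrow> topspace (discrete_topology (points c))"
      using act_closed by (auto simp: topspace_Aut_topology snd_hom_action)
    fix U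
    show "openin ?T {z \<in> topspace ?T. ?a z \<in> U}"
      unfolding openin_prod_topology_alt
    proof (intro allI impI)
      fix g \<chi> assume "(g, \<chi>) \<in> {z \<in> topspace ?T. ?a z \<in> U}"
      then have g: "g \<in> auts" and \<chi>: "\<chi> \<in> points c" and U: "g \<star> \<chi> \<in> U"
        by (auto simp: topspace_Aut_topology snd_hom_action)
      let ?V = "{h \<in> auts. h \<star> \<chi> = g \<star> \<chi>}"
      have "?V \<times> {\<chi>} \<subseteq> {z \<in> topspace ?T. ?a z \<in> U}"
        using \<chi> U by (auto simp: topspace_Aut_topology snd_hom_action)
      then show "\<exists>V W. openin (Aut_topology C u) V \<and> openin (discrete_topology (points c)) W \<and>
          g \<in> V \<and> \<chi> \<in> W \<and> V \<times> W \<subseteq> {z \<in> topspace ?T. ?a z \<in> U}"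
        using openin_transporter[OF \<chi> c] g \<chi>
        by (intro exI[of _ ?V] exI[of _ "{\<chi>}"]) simp
    qed
  qed
  then show ?thesis
    using hom_action_group_action by (simp add: continuous_action_def fst_hom_action)
qed

lemma equivariant_maps_hom_action:
  "m \<in> equivariant_maps G (hom_action C u d) (hom_action C u c) \<longleftrightarrow>
     m \<in> points d \<rightarrow>\<^sub>E points c \<and> (\<forall>g\<in>auts. \<forall>\<xi>\<in>points d. m (g \<star> \<xi>) = g \<star> m \<xi>)"
proof (cases "m \<in> points d \<rightarrow>\<^sub>E points c")
  case True
  then have "m \<xi> \<in> points c" if "\<xi> \<in> points d" for \<xi>
    using that by (rule PiE_mem)
  then show ?thesis
    by (simp add: equivariant_maps_def fst_hom_action snd_hom_action Aut_simps cong: ball_cong)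
qed (simp add: equivariant_maps_def fst_hom_action)

text \<open>Orbit-stabilizer: a point \<open>\<psi>\<close> corresponds to the coset of all
  automorphisms sending \<open>\<chi>\<close> to \<open>\<psi>\<close>. Taking the whole set avoids
  choosing an automorphism. By transitivity the set is nonempty, and any member determines
  \<open>\<psi>\<close>, which gives injectivity.\<close>

lemma hom_action_isomorphic_coset_action:
  assumes c: "c \<in> Obj C" and \<chi>: "\<chi> \<in> points c"
  shows "isomorphic_actions G (hom_action C u c) (coset_action G (fixing C u \<chi>))"
proof -
  define m where "m = (\<lambda>\<psi>\<in>points c. {h \<in> auts. h \<star> \<chi> = \<psi>})"
  have lcosets: "lcosets\<^bsub>G\<^esub> fixing C u \<chi> = (\<lambda>g. {h \<in> auts. h \<star> \<chi> = g \<star> \<chi>}) ` auts"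
    using l_coset_fixing[OF _ \<chi>] by (auto simp: LCOSETS_def Aut_simps)
  have image: "m ` points c = lcosets\<^bsub>G\<^esub> fixing C u \<chi>"
  proof -
    have "points c = (\<lambda>g. g \<star> \<chi>) ` auts"
      using auts_transitive[OF c \<chi>] act_closed[OF _ \<chi>] by (auto simp: image_iff) metis
    then have "m ` points c = (\<lambda>g. m (g \<star> \<chi>)) ` auts"
      by (simp add: image_image)
    also have "\<dots> = lcosets\<^bsub>G\<^esub> fixing C u \<chi>"
      unfolding lcosets using act_closed[OF _ \<chi>] by (intro image_cong) (auto simp: m_def)
    finally show ?thesis .
  qed
  have "inj_on m (points c)"
  proof (rule inj_onI)
    fix \<psi> \<phi> assume \<psi>: "\<psi> \<in> points c" and "\<phi> \<in> points c" and "m \<psi> = m \<phi>"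
    moreover obtain g where "g \<in> auts" "g \<star> \<chi> = \<psi>"
      using auts_transitive[OF c \<chi> \<psi>] .
    ultimately show "\<psi> = \<phi>"
      by (auto simp: m_def)
  qed
  then have bij: "bij_betw m (points c) (lcosets\<^bsub>G\<^esub> fixing C u \<chi>)"
    using image by (simp add: bij_betw_def)
  have equiv: "m (g \<star> \<psi>) = g <#\<^bsub>G\<^esub> m \<psi>" if g: "g \<in> auts" and \<psi>: "\<psi> \<in> points c" for g \<psi>
  proof -
    obtain h where h: "h \<in> auts" "h \<star> \<chi> = \<psi>"
      using auts_transitive[OF c \<chi> \<psi>] .
    interpret group G using Ind.Aut_group[OF u_in] .
    have "g <#\<^bsub>G\<^esub> m \<psi> = g <#\<^bsub>G\<^esub> (h <#\<^bsub>G\<^esub> fixing C u \<chi>)"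
      using l_coset_fixing[OF h(1) \<chi>] h(2) \<psi> by (simp add: m_def)
    also have "\<dots> = (g \<star> h) <#\<^bsub>G\<^esub> fixing C u \<chi>"
      using lcos_m_assoc[of "fixing C u \<chi>" g h] g h(1) by (simp add: Aut_simps fixing_def)
    also have "\<dots> = m (g \<star> \<psi>)"
      using l_coset_fixing[OF Ind.Isos_Comp[OF h(1) g] \<chi>] act_Comp[OF g h(1) \<chi>] h(2) act_closed[OF g \<psi>]
      by (simp add: m_def)
    finally show ?thesis by simp
  qed
  have "m \<in> equivariant_maps G (hom_action C u c) (coset_action G (fixing C u \<chi>))"
    using equiv image
    by (auto simp: equivariant_maps_def coset_action_def fst_hom_action snd_hom_action Aut_simps) (auto simp: m_def)
  then show ?thesis
    using bij by (auto simp: isomorphic_actions_def coset_action_def fst_hom_action)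
qed

section \<open>The functor to continuous actions, its faithfulness and its fullness\<close>

lemma Obj_Cont_fixing: "c \<in> Obj C \<Longrightarrow> hom_action C u c \<in> Obj (Cont_fixing C u)"
  using hom_action_continuous hom_action_isomorphic_coset_action fixing_subgroupsI point_exists
  by (simp add: Cont_fixing_def full_subcategory_simps Cont_def) metis

lemma Homs_Cont_fixing:
  assumes "c \<in> Obj C" "d \<in> Obj C"
  shows "Homs (Cont_fixing C u) (hom_action C u d) (hom_action C u c) =
    {(hom_action C u d, m, hom_action C u c) | m. m \<in> equivariant_maps G (hom_action C u d) (hom_action C u c)}"
proof -
  have "Homs (Cont_fixing C u) (hom_action C u d) (hom_action C u c) =
      Homs (Cont G (Aut_topology C u)) (hom_action C u d) (hom_action C u c)"
    using Obj_Cont_fixing[OF assms(1)] Obj_Cont_fixing[OF assms(2)]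
    by (auto simp: Cont_fixing_def Homs_full_subcategory full_subcategory_simps)
  then show ?thesis
    using assms hom_action_continuous by (auto simp: Homs_Cont)
qed

lemma hom_action_arr_eq:
  "f \<in> Homs C c d \<Longrightarrow> hom_action_arr C u f = (hom_action C u d, \<lambda>\<xi>\<in>points d. \<xi> \<diamondop> f, hom_action C u c)"
  by (simp add: hom_action_arr_def HomsD)

lemma hom_action_functor:
  "cat_functor (opposite C) (Cont_fixing C u) (hom_action C u) (hom_action_arr C u)"
proof -
  interpret op: category "opposite C"
    by (rule opposite_category[OF target.category_axioms])
  interpret K: category "Cont_fixing C u"
    unfolding Cont_fixing_def by (rule full_subcategory_category[OF Cont_category])
  show ?thesis
  proof
    show "hom_action C u c \<in> Obj (Cont_fixing C u)" if "c \<in> Obj (opposite C)" for c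
      using that by (simp add: opposite_simps Obj_Cont_fixing)
    show "hom_action_arr C u f \<in> Homs (Cont_fixing C u) (hom_action C u d) (hom_action C u c)"
      if "f \<in> Homs (opposite C) d c" for f c d
    proof -
      have f: "f \<in> Homs C c d" using that by (simp add: Homs_opposite)
      have "(\<lambda>\<xi>\<in>points d. \<xi> \<diamondop> f) \<in> equivariant_maps G (hom_action C u d) (hom_action C u c)"
        using pull_closed[OF _ f] act_closed act_pull[OF _ _ f] by (simp add: equivariant_maps_hom_action)
      then show ?thesis
        using target.Homs_Obj[OF f] by (simp add: Homs_Cont_fixing hom_action_arr_eq[OF f])
    qed
    show "hom_action_arr C u (Ident (opposite C) c) = Ident (Cont_fixing C u) (hom_action C u c)"
      if "c \<in> Obj (opposite C)" for c
    proof -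
      have "Ident C c \<in> Homs C c c"
        using that target.Ident_closed by (simp add: opposite_simps)
      then show ?thesis
        using pull_Ident
        by (auto simp: opposite_simps hom_action_arr_eq Cont_fixing_def full_subcategory_simps Cont_def
            fst_hom_action intro!: restrict_ext)
    qed
    show "hom_action_arr C u (g \<odot>\<^bsub>opposite C\<^esub> f) =
        hom_action_arr C u g \<odot>\<^bsub>Cont_fixing C u\<^esub> hom_action_arr C u f"
      if "f \<in> Homs (opposite C) a b" "g \<in> Homs (opposite C) b c" for f g a b c
    proof -
      have f: "f \<in> Homs C b a" and g: "g \<in> Homs C c b"
        using that by (simp_all add: Homs_opposite)
      show ?thesis
        using pull_Comp[OF _ f g] pull_closed[OF _ f]
        by (auto simp: opposite_simps hom_action_arr_eq[OF f] hom_action_arr_eq[OF g]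
            hom_action_arr_eq[OF target.Comp_closed[OF g f]] Cont_fixing_def full_subcategory_simps Cont_def
            fst_hom_action compose_def intro!: restrict_ext)
    qed
  qed
qed

text \<open>Precomposition commutes with automorphisms, so by transitivity two arrows that agree
  after one point agree after all points of its domain, and hence induce the same equivariant
  map.\<close>

lemma faithful_iff_monic_points: "faithful (opposite C) (hom_action_arr C u) \<longleftrightarrow> monic_points"
proof
  assume F: "faithful (opposite C) (hom_action_arr C u)"
  show monic_points
    unfolding monic_points_def
  proof (intro ballI impI)
    fix c d f g \<xi>
    assume c: "c \<in> Obj C" and d: "d \<in> Obj C" and f: "f \<in> Homs C c d" and g: "g \<in> Homs C c d"
      and \<xi>: "\<xi> \<in> points d" and eq: "\<xi> \<diamondop> f = \<xi> \<diamondop> g"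
    have "\<psi> \<diamondop> f = \<psi> \<diamondop> g" if \<psi>: "\<psi> \<in> points d" for \<psi>
    proof -
      obtain s where "s \<in> auts" "s \<star> \<xi> = \<psi>"
        using auts_transitive[OF d \<xi> \<psi>] .
      then show ?thesis
        using act_pull[OF _ \<xi> f] act_pull[OF _ \<xi> g] eq by metis
    qed
    then have "hom_action_arr C u f = hom_action_arr C u g"
      by (auto simp: hom_action_arr_eq[OF f] hom_action_arr_eq[OF g] intro!: restrict_ext)
    then show "f = g"
      using F c d f g by (simp add: faithful_def Homs_opposite opposite_simps)
  qed
next
  assume P: monic_points
  show "faithful (opposite C) (hom_action_arr C u)"
    unfolding faithful_def opposite_simps Homs_opposite
  proof (intro ballI impI)
    fix c d f g
    assume d: "d \<in> Obj C" and f: "f \<in> Homs C c d" and g: "g \<in> Homs C c d"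
      and eq: "hom_action_arr C u f = hom_action_arr C u g"
    obtain \<xi> where \<xi>: "\<xi> \<in> points d" using point_exists[OF d] .
    have "(\<lambda>\<xi>\<in>points d. \<xi> \<diamondop> f) \<xi> = (\<lambda>\<xi>\<in>points d. \<xi> \<diamondop> g) \<xi>"
      using eq unfolding hom_action_arr_eq[OF f] hom_action_arr_eq[OF g] by simp
    then have "\<xi> \<diamondop> f = \<xi> \<diamondop> g" using \<xi> by simp
    then show "f = g" by (rule monic_pointsD[OF P \<xi> f g])
  qed
qed

text \<open>By transitivity, an equivariant map out of \<open>points d\<close> amounts to a choice of the image of one point.\<close>

lemma equivariant_map_exists:
  assumes d: "d \<in> Obj C" and \<xi>: "\<xi> \<in> points d" and \<chi>: "\<chi> \<in> points c"
    and sub: "fixing C u \<xi> \<subseteq> fixing C u \<chi>"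
  obtains m where "m \<in> equivariant_maps G (hom_action C u d) (hom_action C u c)" "m \<xi> = \<chi>"
proof -
  have "\<exists>g. g \<in> auts \<and> g \<star> \<xi> = \<psi>" if "\<psi> \<in> points d" for \<psi>
    using auts_transitive[OF d \<xi> that] by blast
  then obtain t where t: "\<And>\<psi>. \<psi> \<in> points d \<Longrightarrow> t \<psi> \<in> auts \<and> t \<psi> \<star> \<xi> = \<psi>"
    by metis
  define m where "m = (\<lambda>\<psi>\<in>points d. t \<psi> \<star> \<chi>)"
  \<comment> \<open>Independence of the choice: \<open>t (g \<star> \<xi>)\<close> and
    \<open>g\<close> agree on \<open>\<xi>\<close>, so by the inclusion of stabilizers they agree on
    \<open>\<chi>\<close>.\<close>
  have m: "m (g \<star> \<xi>) = g \<star> \<chi>" if g: "g \<in> auts" for g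
    using t[OF act_closed[OF g \<xi>]] fixing_subset_act_eq[OF sub \<xi> \<chi> _ g] act_closed[OF g \<xi>]
    by (simp add: m_def)
  have "m (g \<star> \<psi>) = g \<star> m \<psi>" if g: "g \<in> auts" and \<psi>: "\<psi> \<in> points d" for g \<psi>
  proof -
    have "g \<star> \<psi> = g \<star> t \<psi> \<star> \<xi>"
      using act_Comp[OF g _ \<xi>] t[OF \<psi>] by simp
    then have "m (g \<star> \<psi>) = g \<star> t \<psi> \<star> \<chi>"
      using m[OF Ind.Isos_Comp[OF _ g]] t[OF \<psi>] by simp
    then show ?thesis
      using act_Comp[OF g _ \<chi>] t[OF \<psi>] \<psi> by (simp add: m_def)
  qed
  moreover have "m \<in> points d \<rightarrow>\<^sub>E points c"
    using t act_closed[OF _ \<chi>] by (simp add: m_def)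
  ultimately have "m \<in> equivariant_maps G (hom_action C u d) (hom_action C u c)"
    by (simp add: equivariant_maps_hom_action)
  moreover have "m \<xi> = \<chi>"
    using m[OF Ind.Ident_Isos[OF u_in]] act_Ident[OF \<xi>] act_Ident[OF \<chi>] by simp
  ultimately show thesis
    by (rule that)
qed

text \<open>Fullness is tested on the equivariant map sending \<open>\<xi>\<close> to
  \<open>\<chi>\<close>, whose preimage is the factorizing arrow. Conversely, equivariant maps can
  only enlarge stabilizers, so \<open>m \<xi>\<close> factors through \<open>\<xi>\<close> by an
  arrow that induces all of \<open>m\<close>.\<close>

lemma full_iff_fixing_factors:
  "full (opposite C) (Cont_fixing C u) (hom_action C u) (hom_action_arr C u) \<longleftrightarrow> fixing_factors"
proof
  assume F: "full (opposite C) (Cont_fixing C u) (hom_action C u) (hom_action_arr C u)"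
  show fixing_factors
    unfolding fixing_factors_def
  proof (intro ballI impI)
    fix c d \<chi> \<xi>
    assume c: "c \<in> Obj C" and d: "d \<in> Obj C" and \<chi>: "\<chi> \<in> points c" and \<xi>: "\<xi> \<in> points d"
      and sub: "fixing C u \<xi> \<subseteq> fixing C u \<chi>"
    obtain m where m: "m \<in> equivariant_maps G (hom_action C u d) (hom_action C u c)" "m \<xi> = \<chi>"
      using equivariant_map_exists[OF d \<xi> \<chi> sub] .
    then have "(hom_action C u d, m, hom_action C u c) \<in> Homs (Cont_fixing C u) (hom_action C u d) (hom_action C u c)"
      using Homs_Cont_fixing[OF c d] by blast
    then obtain f where f: "f \<in> Homs C c d" and "hom_action_arr C u f = (hom_action C u d, m, hom_action C u c)"
      using F c d unfolding full_def opposite_simps Homs_opposite by blast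
    then have "m = (\<lambda>\<xi>\<in>points d. \<xi> \<diamondop> f)"
      by (simp add: hom_action_arr_eq[OF f])
    then show "\<exists>f\<in>Homs C c d. \<chi> = \<xi> \<diamondop> f"
      using f m(2) \<xi> by auto
  qed
next
  assume Q: fixing_factors
  show "full (opposite C) (Cont_fixing C u) (hom_action C u) (hom_action_arr C u)"
    unfolding full_def opposite_simps Homs_opposite
  proof (intro ballI)
    fix d c \<mu>
    assume d: "d \<in> Obj C" and c: "c \<in> Obj C"
      and "\<mu> \<in> Homs (Cont_fixing C u) (hom_action C u d) (hom_action C u c)"
    then obtain m where \<mu>: "\<mu> = (hom_action C u d, m, hom_action C u c)"
      and m: "m \<in> points d \<rightarrow>\<^sub>E points c"
      and equiv: "\<And>g \<xi>. \<lbrakk>g \<in> auts; \<xi> \<in> points d\<rbrakk> \<Longrightarrow> m (g \<star> \<xi>) = g \<star> m \<xi>"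
      by (auto simp: Homs_Cont_fixing equivariant_maps_hom_action)
    obtain \<xi> where \<xi>: "\<xi> \<in> points d" using point_exists[OF d] .
    have m\<xi>: "m \<xi> \<in> points c" using m \<xi> by (rule PiE_mem)
    have "fixing C u \<xi> \<subseteq> fixing C u (m \<xi>)"
    proof
      fix g assume "g \<in> fixing C u \<xi>"
      then show "g \<in> fixing C u (m \<xi>)"
        using equiv[OF _ \<xi>, of g] by (simp add: fixing_def)
    qed
    then obtain f where f: "f \<in> Homs C c d" and m\<xi>f: "m \<xi> = \<xi> \<diamondop> f"
      by (rule fixing_factorsE[OF Q m\<xi> \<xi> c d])
    \<comment> \<open>Both sides are equivariant and agree at \<open>\<xi>\<close>, whose orbit is
      all of \<open>points d\<close>.\<close>
    have "m = (\<lambda>\<xi>\<in>points d. \<xi> \<diamondop> f)"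
    proof (rule extensionalityI)
      show "m \<in> extensional (points d)" using m by (simp add: PiE_iff)
      fix \<psi> assume \<psi>: "\<psi> \<in> points d"
      obtain g where g: "g \<in> auts" "g \<star> \<xi> = \<psi>"
        using auts_transitive[OF d \<xi> \<psi>] .
      have "m \<psi> = g \<star> (\<xi> \<diamondop> f)"
        using equiv[OF g(1) \<xi>] g(2) m\<xi>f by simp
      also have "\<dots> = \<psi> \<diamondop> f"
        using act_pull[OF g(1) \<xi> f] g(2) by simp
      finally show "m \<psi> = (\<lambda>\<xi>\<in>points d. \<xi> \<diamondop> f) \<psi>"
        using \<psi> by simp
    qed simp
    then show "\<exists>f\<in>Homs C c d. hom_action_arr C u f = \<mu>"
      using f \<mu> hom_action_arr_eq[OF f] by auto
  qed
qed

lemma full_and_faithful_iff: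
  "full_and_faithful_functor (opposite C) (Cont_fixing C u) (hom_action C u) (hom_action_arr C u) \<longleftrightarrow>
     monic_points \<and> fixing_factors"
  using hom_action_functor faithful_iff_monic_points full_iff_fixing_factors
  by (auto simp: full_and_faithful_functor_def)

end

theorem theorem4p1:
  fixes C :: "('o, 'a) cat"
    and u :: "('i, 'j, 'o, 'a) diagram"
  assumes "category C"
    and "amalgamation_property C"
    and "joint_embedding_property C"
    and "u \<in> Obj (Ind C)"
    and "universal_object C u"
    and "ultrahomogeneous C u"
  shows "((\<forall>f\<in>Arr C. strict_monomorphism C f) \<longleftrightarrow>
          full_and_faithful_functor (opposite C) (Cont_fixing C u)
            (hom_action C u) (hom_action_arr C u)) \<and>
         (full_and_faithful_functor (opposite C) (Cont_fixing C u)
            (hom_action C u) (hom_action_arr C u) \<longleftrightarrow>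
          (\<forall>c\<in>Obj C. \<forall>d\<in>Obj C.
             \<forall>\<chi>\<in>Homs (Ind C) (emb C c) u. \<forall>\<xi>\<in>Homs (Ind C) (emb C d) u.
               fixing C u \<xi> \<subseteq> fixing C u \<chi> \<longleftrightarrow>
               (\<exists>!f. f \<in> Homs C c d \<and> \<chi> = \<xi> \<odot>\<^bsub>Ind C\<^esub> emb_arr C f)))"
proof -
  interpret homogeneous_object C u
    using assms by (simp add: homogeneous_object_def homogeneous_object_axioms_def Obj_Ind)
  show ?thesis
    using strict_monomorphisms_iff full_and_faithful_iff unique_factor_iff by blast
qed

end
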